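(* Let $\Lambda$ be a block with $\mathrm{def}(\Lambda)<\infty$, and let $\tau:H_\Lambda\to\mathbb C$ be the linear map sending a basis vector $(a\lambda b)$ to $1$ if $\deg(a\lambda b)=2\,\mathrm{def}(\Lambda)$ and to $0$ otherwise. Then for basis vectors $(a\lambda b),(c\mu d)$ of $H_\Lambda$, $$\tau((a\lambda b)(c\mu d))=\begin{cases}1&\text{if }(c\mu d)=(a\lambda b)^\#,\\0&\text{otherwise.}\end{cases}$$ Hence $\tau$ is a symmetrising form (the bilinear form $x\otimes y\mapsto\tau(xy)$ is non-degenerate and symmetric) and $H_\Lambda$ is a symmetric algebra.
   Context: A number line carries vertices indexed by consecutive integers. A weight labels each vertex by $\circ,\times,\vee,\wedge$ with, outside a finite set, no $\vee$ to the left of an $\wedge$. Blocks: classes of weights related by permuting $\vee$'s and $\wedge$'s. Cup diagrams: finitely many non-crossing cups joining pairs of vertices plus rays down to infinity; cap diagrams similarly upward; $c^*$ = mirror image in the number line. $c\lambda$ is an oriented cup diagram if free vertices are $\circ/\times$, each cup has one $\vee$ and one $\wedge$ end, ray vertices are $\vee/\wedge$, and no two rays are labelled $\vee,\wedge$ in that order left to right; $\lambda c$ for a cap diagram is oriented if $c^*\lambda$ is. Clockwise cup/cap: left end labelled $\wedge$; degree of an oriented circle diagram $a\lambda b$ ($a\lambda$, $\lambda b$ oriented) = number of clockwise cups and caps. A circle in it is anticlockwise (type $1$) if its leftmost vertex is $\vee$, clockwise (type $x$) otherwise; reversing the orientation of a circle means swapping $\vee\leftrightarrow\wedge$ on all its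 vertices. $\underline\lambda$: unique cup diagram with $\underline\lambda\lambda$ oriented of degree $0$; $\overline\lambda=(\underline\lambda)^*$; $\mu\subset\lambda$: same block and $\underline\mu\lambda$ oriented. $\mathrm{def}(\lambda)$ = number of cups in $\underline\lambda$; $\mathrm{def}(\Lambda)=\sup_{\lambda\in\Lambda}\mathrm{def}(\lambda)$. $K_\Lambda$: graded algebra with basis $(a\lambda b)$ over oriented circle diagrams with $\lambda\in\Lambda$, with product of two basis vectors $(a\lambda b)(c\mu d)$ equal to $0$ unless $c=b^*$, and otherwise computed by: drawing $a\lambda b$ below $c\mu d$ and joining corresponding rays; iterating surgery (cut a mirror-symmetric cap/cup pair of the middle section connectable without crossings, rejoin as two vertical segments, and reorient using $1\otimes1\mapsto1$, $1\otimes x\mapsto x$, $x\otimes1\mapsto x$, $x\otimes x\mapsto0$, $1\mapsto1\otimes x+x\otimes1$, $x\mapsto x\otimes x$ for circles, and $1\otimes y\mapsto y$, $x\otimes y\mapsto0$, $y\mapsto x\otimes y$ for a circle and a line $y$, and $y\otimes y\mapsto y\otimes y$ if the rays of one line are both $\wedge$ and of the other both $\vee$, $0$ otherwise, for two lines; ray orientations never change); then identifying top and bottom number lines and summing the resulting basis vectors. $e_\lambda=(\underline\lambda\lambda\overline\lambda)$. $\Lambda^\circ=\{\lambda\in\Lambda\mid\mathrm{def}(\lambda)=\mathrm{def}(\Lambda)\}$; the generalised Khovanov algebra is $H_\Lambda=\bigoplus_{\alpha,\beta\in\Lambda^\circ}e_\alpha K_\Lambda e_\beta$, with basis $(\underline\alpha\lambda\overline\beta)$,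 $\alpha,\beta\in\Lambda^\circ$, $\lambda\in\Lambda$, $\alpha\subset\lambda\supset\beta$. For a basis vector $(a\lambda b)\in H_\Lambda$, $(a\lambda b)^\#$ denotes the basis vector of $H_\Lambda$ whose diagram is obtained from $b^*\lambda a^*$ by reversing the orientation of every circle. *)

theory Defs
  imports Complex_Main
begin

text \<open>Vertex labels: Circ = o, Cross = x, Dn = vee (down), Up = wedge (up).\<close>
datatype lab = Circ | Cross | Dn | Up

type_synonym weight = "int \<Rightarrow> lab"

text \<open>A cup (or cap) diagram: a set of cups (i,j) with i<j, plus a set of ray vertices.
  Vertices in neither are free. A cap diagram is stored by the same data as its mirror
  image cup diagram, so c* has the same data as c.\<close>
type_synonym diag = "(int \<times> int) set \<times> int set"

text \<open>Nodes of a stacked diagram: (False,k) = vertex k on bottom number line,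
  (True,k) = vertex k on top number line.\<close>
type_synonym node = "bool \<times> int"
type_synonym lbl = "node \<Rightarrow> lab"

text \<open>Basis vectors (a lambda b): cup diagram a, weight lambda, cap diagram b.\<close>
type_synonym bvec = "diag \<times> weight \<times> diag"

definition is_weight :: "weight \<Rightarrow> bool" where
  "is_weight w \<longleftrightarrow>
     (\<exists>F. finite F \<and> (\<forall>i j. i \<notin> F \<longrightarrow> j \<notin> F \<longrightarrow> i < j \<longrightarrow> \<not> (w i = Dn \<and> w j = Up)))"

definition block_rel :: "weight \<Rightarrow> weight \<Rightarrow> bool" where
  "block_rel w v \<longleftrightarrow>
     (\<exists>\<pi>::int \<Rightarrow> int. bij \<pi> \<and> finite {i. \<pi> i \<noteq> i} \<and>
        (\<forall>i. \<pi> i \<noteq> i \<longrightarrow> w i \<in> {Dn, Up}) \<and> v = w \<circ> \<pi>)"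

definition is_block :: "weight set \<Rightarrow> bool" where
  "is_block \<Lambda> \<longleftrightarrow> (\<exists>w. is_weight w \<and> \<Lambda> = {v. is_weight v \<and> block_rel w v})"

definition ends :: "(int \<times> int) set \<Rightarrow> int set" where
  "ends C = fst ` C \<union> snd ` C"

definition cup_diagram :: "diag \<Rightarrow> bool" where
  "cup_diagram c \<longleftrightarrow>
     finite (fst c) \<and>
     (\<forall>(i,j)\<in>fst c. i < j) \<and>
     (\<forall>(i,j)\<in>fst c. \<forall>(k,l)\<in>fst c. (i,j) \<noteq> (k,l) \<longrightarrow> i \<noteq> k \<and> i \<noteq> l \<and> j \<noteq> k \<and> j \<noteq> l) \<and>
     (\<forall>(i,j)\<in>fst c. \<forall>(k,l)\<in>fst c. \<not> (i < k \<and> k < j \<and> j < l)) \<and>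
     snd c \<inter> ends (fst c) = {} \<and>
     (\<forall>(i,j)\<in>fst c. \<forall>r\<in>snd c. \<not> (i < r \<and> r < j))"

text \<open>c w is an oriented cup diagram (equivalently w c* oriented cap diagram).\<close>
definition oriented :: "diag \<Rightarrow> weight \<Rightarrow> bool" where
  "oriented c w \<longleftrightarrow>
     (\<forall>k. k \<notin> ends (fst c) \<longrightarrow> k \<notin> snd c \<longrightarrow> w k \<in> {Circ, Cross}) \<and>
     (\<forall>(i,j)\<in>fst c. {w i, w j} = {Dn, Up}) \<and>
     (\<forall>k\<in>snd c. w k \<in> {Dn, Up}) \<and>
     (\<forall>k\<in>snd c. \<forall>l\<in>snd c. k < l \<longrightarrow> \<not> (w k = Dn \<and> w l = Up))"

text \<open>Number of clockwise cups (left end labelled wedge).\<close>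
definition cdeg :: "diag \<Rightarrow> weight \<Rightarrow> nat" where
  "cdeg c w = card {p \<in> fst c. w (fst p) = Up}"

definition lower :: "weight \<Rightarrow> diag" where
  "lower w = (THE c. cup_diagram c \<and> oriented c w \<and> cdeg c w = 0)"

definition defect :: "weight \<Rightarrow> nat" where
  "defect w = card (fst (lower w))"

definition defB :: "weight set \<Rightarrow> nat" where
  "defB \<Lambda> = Sup (defect ` \<Lambda>)"

definition core :: "weight set \<Rightarrow> weight set" where
  "core \<Lambda> = {w \<in> \<Lambda>. defect w = defB \<Lambda>}"

definition subw :: "weight \<Rightarrow> weight \<Rightarrow> bool" where
  "subw m w \<longleftrightarrow> block_rel m w \<and> oriented (lower m) w"

text \<open>Basis of H_Lambda: (lower alpha) lambda (upper beta); upper beta has the same data as lower beta.\<close>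
definition basisH :: "weight set \<Rightarrow> bvec set" where
  "basisH \<Lambda> = {(lower \<alpha>, w, lower \<beta>) | \<alpha> w \<beta>.
      \<alpha> \<in> core \<Lambda> \<and> \<beta> \<in> core \<Lambda> \<and> w \<in> \<Lambda> \<and> subw \<alpha> w \<and> subw \<beta> w}"

definition deg :: "bvec \<Rightarrow> nat" where
  "deg x = cdeg (fst x) (fst (snd x)) + cdeg (snd (snd x)) (fst (snd x))"

definition conn1 :: "diag \<Rightarrow> diag \<Rightarrow> (int \<times> int) set" where
  "conn1 a b = (fst a \<union> fst b \<union> (fst a)\<inverse> \<union> (fst b)\<inverse>)\<^sup>*"

definition in_circle :: "diag \<Rightarrow> diag \<Rightarrow> int \<Rightarrow> bool" where
  "in_circle a b k \<longleftrightarrow> k \<in> ends (fst a) \<and>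
     (\<forall>m. (k, m) \<in> conn1 a b \<longrightarrow> m \<in> ends (fst a) \<and> m \<in> ends (fst b))"

fun swap :: "lab \<Rightarrow> lab" where
  "swap Dn = Up" | "swap Up = Dn" | "swap Circ = Circ" | "swap Cross = Cross"

definition sharp :: "bvec \<Rightarrow> bvec" where
  "sharp x = (case x of (a, w, b) \<Rightarrow>
      (b, \<lambda>k. if in_circle a b k then swap (w k) else w k, a))"

text \<open>Stacked diagram: a (cups below bottom line), remaining middle cap/cup pairs R
  (caps above bottom line, mirror cups below top line), d (caps above top line),
  vertical segments at ray vertices of b and at cup ends of b already cut.\<close>
definition arcs :: "diag \<Rightarrow> diag \<Rightarrow> (int \<times> int) set \<Rightarrow> (node \<times> node) set" where
  "arcs a d R =
     {((False, i), (False, j)) | i j. (i, j) \<in> fst a \<union> R} \<union>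
     {((True, i), (True, j)) | i j. (i, j) \<in> R \<union> fst d}"

definition verts :: "diag \<Rightarrow> (int \<times> int) set \<Rightarrow> (node \<times> node) set" where
  "verts b R = {((False, k), (True, k)) | k. k \<in> (ends (fst b) - ends R) \<union> snd b}"

definition sconn :: "diag \<Rightarrow> diag \<Rightarrow> diag \<Rightarrow> (int \<times> int) set \<Rightarrow> (node \<times> node) set" where
  "sconn a b d R = (arcs a d R \<union> verts b R \<union> (arcs a d R \<union> verts b R)\<inverse>)\<^sup>*"

definition scomp :: "diag \<Rightarrow> diag \<Rightarrow> diag \<Rightarrow> (int \<times> int) set \<Rightarrow> node \<Rightarrow> node set" where
  "scomp a b d R n = {m. (n, m) \<in> sconn a b d R}"

definition rayend :: "diag \<Rightarrow> diag \<Rightarrow> node \<Rightarrow> bool" where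
  "rayend a d n = (if fst n then snd n \<in> snd d else snd n \<in> snd a)"

definition is_line :: "diag \<Rightarrow> diag \<Rightarrow> node set \<Rightarrow> bool" where
  "is_line a d C \<longleftrightarrow> (\<exists>n\<in>C. rayend a d n)"

definition consistent :: "diag \<Rightarrow> diag \<Rightarrow> diag \<Rightarrow> (int \<times> int) set \<Rightarrow> lbl \<Rightarrow> bool" where
  "consistent a b d R L \<longleftrightarrow>
     (\<forall>(n, m)\<in>arcs a d R. {L n, L m} = {Dn, Up}) \<and>
     (\<forall>(n, m)\<in>verts b R. L n = L m \<and> L n \<in> {Dn, Up})"

text \<open>A circle is anticlockwise (type 1) iff its leftmost vertex is labelled vee.\<close>
definition type1 :: "lbl \<Rightarrow> node set \<Rightarrow> bool" where
  "type1 L C = (let k = Min (snd ` C) in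
      L (if (False, k) \<in> C then (False, k) else (True, k)) = Dn)"

definition rays_are :: "diag \<Rightarrow> diag \<Rightarrow> lbl \<Rightarrow> node set \<Rightarrow> lab \<Rightarrow> bool" where
  "rays_are a d L C s \<longleftrightarrow> (\<forall>n\<in>C. rayend a d n \<longrightarrow> L n = s)"

definition single :: "lbl \<Rightarrow> lbl \<Rightarrow> complex" where
  "single L = (\<lambda>M. if M = L then 1 else 0)"

definition reorient :: "diag \<Rightarrow> diag \<Rightarrow> diag \<Rightarrow> (int \<times> int) set \<Rightarrow> lbl \<Rightarrow> node set
      \<Rightarrow> (lbl \<Rightarrow> bool) \<Rightarrow> lbl \<Rightarrow> complex" where
  "reorient a b d R L C spec =
     (if \<exists>L'. consistent a b d R L' \<and> (\<forall>n. n \<notin> C \<or> rayend a d n \<longrightarrow> L' n = L n) \<and> spec L'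
      then single (SOME L'. consistent a b d R L' \<and> (\<forall>n. n \<notin> C \<or> rayend a d n \<longrightarrow> L' n = L n) \<and> spec L')
      else (\<lambda>_. 0))"

definition surg1 :: "diag \<Rightarrow> diag \<Rightarrow> diag \<Rightarrow> (int \<times> int) set \<Rightarrow> int \<times> int \<Rightarrow> lbl \<Rightarrow> lbl \<Rightarrow> complex" where
  "surg1 a b d R p L =
    (let R' = R - {p}; i = fst p; j = snd p;
         P = scomp a b d R (False, i); Q = scomp a b d R (True, i);
         P' = scomp a b d R' (False, i); Q' = scomp a b d R' (False, j);
         ro = reorient a b d R' L
     in if P \<noteq> Q then
          (if \<not> is_line a d P \<and> \<not> is_line a d Q then
             (if \<not> type1 L P \<and> \<not> type1 L Q then (\<lambda>_. 0)
              else ro (P \<union> Q) (\<lambda>L'. type1 L' P' = (type1 L P \<and> type1 L Q)))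
           else if \<not> is_line a d P \<and> is_line a d Q then
             (if type1 L P then ro (P \<union> Q) (\<lambda>_. True) else (\<lambda>_. 0))
           else if is_line a d P \<and> \<not> is_line a d Q then
             (if type1 L Q then ro (P \<union> Q) (\<lambda>_. True) else (\<lambda>_. 0))
           else
             (if (rays_are a d L P Up \<and> rays_are a d L Q Dn) \<or> (rays_are a d L P Dn \<and> rays_are a d L Q Up)
              then ro (P \<union> Q) (\<lambda>_. True) else (\<lambda>_. 0)))
        else
          (if \<not> is_line a d P then
             (if type1 L P
              then (\<lambda>M. ro P (\<lambda>L'. type1 L' P' \<and> \<not> type1 L' Q') M
                        + ro P (\<lambda>L'. \<not> type1 L' P' \<and> type1 L' Q') M)
              else ro P (\<lambda>L'. \<not> type1 L' P' \<and> \<not> type1 L' Q'))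
           else ro P (\<lambda>L'. \<not> type1 L' (if is_line a d P' then Q' else P'))))"

definition surg_comb :: "diag \<Rightarrow> diag \<Rightarrow> diag \<Rightarrow> (int \<times> int) set \<Rightarrow> int \<times> int
      \<Rightarrow> (lbl \<Rightarrow> complex) \<Rightarrow> lbl \<Rightarrow> complex" where
  "surg_comb a b d R p f = (\<lambda>M. \<Sum>L\<in>{L. f L \<noteq> 0}. f L * surg1 a b d R p L M)"

primrec run :: "diag \<Rightarrow> diag \<Rightarrow> diag \<Rightarrow> (int \<times> int) list \<Rightarrow> (int \<times> int) set
      \<Rightarrow> (lbl \<Rightarrow> complex) \<Rightarrow> lbl \<Rightarrow> complex" where
  "run a b d [] R f = f"
| "run a b d (p # ps) R f = run a b d ps (R - {p}) (surg_comb a b d R p f)"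

text \<open>Order of surgeries: widest caps first (so each pair is connectable without crossings).\<close>
definition surg_order :: "(int \<times> int) set \<Rightarrow> (int \<times> int) list" where
  "surg_order R = (SOME xs. set xs = R \<and> distinct xs \<and>
       sorted_wrt (\<lambda>p q. snd q - fst q \<le> snd p - fst p) xs)"

definition prod_basis :: "bvec \<Rightarrow> bvec \<Rightarrow> bvec \<Rightarrow> complex" where
  "prod_basis x y = (case x of (a, w, b) \<Rightarrow> case y of (c, v, d) \<Rightarrow>
     if c \<noteq> b then (\<lambda>_. 0) else
     (let f = run a b d (surg_order (fst b)) (fst b)
                (single (\<lambda>n. if fst n then v (snd n) else w (snd n)))
      in (\<lambda>z. if fst z = a \<and> snd (snd z) = d
              then (\<Sum>L\<in>{L. f L \<noteq> 0 \<and> (\<lambda>k. L (False, k)) = fst (snd z)}. f L)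
              else 0)))"

definition prod_left :: "(bvec \<Rightarrow> complex) \<Rightarrow> bvec \<Rightarrow> bvec \<Rightarrow> complex" where
  "prod_left g y = (\<lambda>z. \<Sum>x\<in>{x. g x \<noteq> 0}. g x * prod_basis x y z)"

definition tau :: "weight set \<Rightarrow> (bvec \<Rightarrow> complex) \<Rightarrow> complex" where
  "tau \<Lambda> g = (\<Sum>z\<in>{z \<in> basisH \<Lambda>. g z \<noteq> 0 \<and> deg z = 2 * defB \<Lambda>}. g z)"

end

theory Submission
  imports Defs
begin

text \<open>
  In a block of finite defect all rays of the diagrams of maximal defect carry one and the same
  label, for otherwise two rays could be joined to a further cup. Hence a basis vector of degree
  \<open>2 def\<close> has all cups and caps clockwise, is of the form \<open>(a u a\<^sup>*)\<close>, and \<open>u\<close> is determined by \<open>a\<close>;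
  so \<open>\<tau>\<close> reads off one coefficient of the product, which vanishes unless the outer diagrams agree.

  When they agree, the stacked diagram is invariant under the mirror symmetry at every stage: a
  component meeting a vertical segment is the union of two mirror images, and every other component
  is a circle having a disjoint mirror image. Call an orientation good if every symmetric
  circle is clockwise and every mirror pair of circles has opposite orientations. One surgery
  merges a mirror pair or splits a symmetric component, and in each case the number of good
  orientations, weighted by coefficients, is preserved. At the end the good orientation is the one of
  top degree; at the beginning goodness of \<open>(a \<lambda> b)(b \<mu> a)\<close> says that \<open>\<mu>\<close> is \<open>\<lambda>\<close> with all
  circles reversed. The order of the surgeries is irrelevant for this count.
\<close>

section \<open>Heights and the associated cup diagram\<close>

text \<open>Which surgery rule applies depends on planar facts: does a cut merge or split, can a
  line break into two lines, can a circle fall apart. These facts are obtained from labels instead.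
  With vee counted as 1 and wedge as -1 every arc contributes 0, so counting a component once along
  the arcs of \<open>a\<close> and once along the remaining caps relates its rays to its vertical
  segments; as all rays carry one label, a zero count means no ray at all. Where counting is too
  coarse, a walk directed by the labels takes over.

  Goodness comes from the trace 1 -> 0, x -> 1 on C[x]/(x^2), applied to each symmetric circle and
  to the product of the two types in each mirror pair. The trace of a product of types is nonzero
  exactly for opposite types, and tracing both factors of the coproduct gives 0 on 1 and 1 on x;
  hence merging and splitting both preserve the count.

  \<open>reorient\<close> makes an unspecified choice, so only the circle types it prescribes are
  ever used. Symmetry of the form is read off from the involutivity of #.\<close>

definition sg :: "lab \<Rightarrow> int" where
  "sg l = (case l of Dn \<Rightarrow> 1 | Up \<Rightarrow> -1 | Circ \<Rightarrow> 0 | Cross \<Rightarrow> 0)"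

lemma sg_simps [simp]: "sg Dn = 1" "sg Up = -1" "sg Circ = 0" "sg Cross = 0"
  by (simp_all add: sg_def)

lemma sg_pos_iff: "sg l > 0 \<longleftrightarrow> l = Dn" and sg_neg_iff: "sg l < 0 \<longleftrightarrow> l = Up"
  by (cases l; simp)+

lemma sg_bounds: "sg l \<le> 1" "- 1 \<le> sg l"
  by (cases l; simp)+

definition ht :: "weight \<Rightarrow> int \<Rightarrow> int \<Rightarrow> int" where
  "ht w i j = (\<Sum>m\<in>{i..j}. sg (w m))"

text \<open>Bracket matching with vee as opening and wedge as closing bracket. The cups of the
  degree-zero diagram turn out to be exactly these pairs, which makes \<open>lower\<close>
  explicit.\<close>

definition matched :: "weight \<Rightarrow> (int \<times> int) set" where
  "matched w = {(i, j). i < j \<and> ht w i j = 0 \<and> (\<forall>k. i \<le> k \<and> k < j \<longrightarrow> ht w i k > 0)}"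

lemma ht_split: "i \<le> k \<Longrightarrow> k < j \<Longrightarrow> ht w i j = ht w i k + ht w (k + 1) j"
proof -
  assume "i \<le> k" "k < j"
  then have "{i..j} = {i..k} \<union> {k + 1..j}" "{i..k} \<inter> {k + 1..j} = {}" by auto
  then show ?thesis unfolding ht_def by (simp add: sum.union_disjoint)
qed

lemma ht_same [simp]: "ht w i i = sg (w i)"
  by (simp add: ht_def)

lemma ht_last: "i < j \<Longrightarrow> ht w i j = ht w i (j - 1) + sg (w j)"
  using ht_split[of i "j - 1" j w] by simp

lemma ht_first: "i < j \<Longrightarrow> ht w i j = sg (w i) + ht w (i + 1) j"
  using ht_split[of i i j w] by simp

lemma matched_less: "(i, j) \<in> matched w \<Longrightarrow> i < j"
  and matched_zero: "(i, j) \<in> matched w \<Longrightarrow> ht w i j = 0"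
  and matched_prefix: "(i, j) \<in> matched w \<Longrightarrow> i \<le> k \<Longrightarrow> k < j \<Longrightarrow> ht w i k > 0"
  by (auto simp: matched_def)

lemma matched_suffix: "(i, j) \<in> matched w \<Longrightarrow> i < k \<Longrightarrow> k \<le> j \<Longrightarrow> ht w k j < 0"
  using ht_split[of i "k - 1" j w] matched_prefix[of i j w "k - 1"] matched_zero[of i j w] by simp

lemma matched_left: "(i, j) \<in> matched w \<Longrightarrow> w i = Dn"
  using matched_prefix[of i j w i] matched_less[of i j w] sg_pos_iff by simp

lemma matched_right: "(i, j) \<in> matched w \<Longrightarrow> w j = Up"
  using matched_suffix[of i j w j] matched_less[of i j w] sg_neg_iff by simp

lemma matched_inj_left: "(i, j) \<in> matched w \<Longrightarrow> (i, l) \<in> matched w \<Longrightarrow> j = l"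
  using matched_prefix[of i j w l] matched_prefix[of i l w j]
    matched_zero[of i j w] matched_zero[of i l w] matched_less[of i j w] matched_less[of i l w]
  by (cases j l rule: linorder_cases) auto

lemma matched_inj_right: "(i, j) \<in> matched w \<Longrightarrow> (k, j) \<in> matched w \<Longrightarrow> i = k"
  using matched_suffix[of i j w k] matched_suffix[of k j w i]
    matched_zero[of i j w] matched_zero[of k j w] matched_less[of i j w] matched_less[of k j w]
  by (cases i k rule: linorder_cases) auto

lemma matched_noncrossing:
  "(i, j) \<in> matched w \<Longrightarrow> (k, l) \<in> matched w \<Longrightarrow> \<not> (i < k \<and> k < j \<and> j < l)"
  using matched_suffix[of i j w k] matched_prefix[of k l w j] by auto

text \<open>Heights start at 1 and move by at most one per step, so the first nonpositive height is
  exactly 0, and its position is the partner.\<close>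

lemma matched_from_left:
  assumes "w r = Dn" "r \<le> j" "ht w r j \<le> 0"
  shows "\<exists>l. (r, l) \<in> matched w"
proof -
  define n where "n = (LEAST n. ht w r (r + int n) \<le> 0)"
  have ex: "ht w r (r + int (nat (j - r))) \<le> 0" using assms by simp
  have n: "ht w r (r + int n) \<le> 0"
    unfolding n_def using ex by (rule LeastI)
  have less: "ht w r (r + int m) > 0" if "m < n" for m
    using not_less_Least[of m "\<lambda>n. ht w r (r + int n) \<le> 0"] that unfolding n_def by auto
  have "n > 0" using n assms(1) by (cases n) auto
  have "ht w r (r + int n - 1) > 0" using less[of "n - 1"] \<open>n > 0\<close> by (simp add: of_nat_diff algebra_simps)
  then have "ht w r (r + int n) = 0"
    using n ht_last[of r "r + int n" w] sg_bounds[of "w (r + int n)"] \<open>n > 0\<close> by auto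
  moreover have "ht w r k > 0" if "r \<le> k" "k < r + int n" for k
    using less[of "nat (k - r)"] that by auto
  ultimately have "(r, r + int n) \<in> matched w" using \<open>n > 0\<close> by (auto simp: matched_def)
  then show ?thesis by blast
qed

text \<open>The mirror-image search, going left. Positivity of the prefixes is recovered by
  subtracting the negative suffixes from the total 0.\<close>

lemma matched_from_right:
  assumes "w r = Up" "i \<le> r" "ht w i r \<ge> 0"
  shows "\<exists>k. (k, r) \<in> matched w"
proof -
  define n where "n = (LEAST n. ht w (r - int n) r \<ge> 0)"
  have ex: "ht w (r - int (nat (r - i))) r \<ge> 0" using assms by simp
  have n: "ht w (r - int n) r \<ge> 0"
    unfolding n_def using ex by (rule LeastI)
  have less: "ht w (r - int m) r < 0" if "m < n" for m
    using not_less_Least[of m "\<lambda>n. ht w (r - int n) r \<ge> 0"] that unfolding n_def by auto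
  have "n > 0" using n assms(1) by (cases n) auto
  have "ht w (r - int n + 1) r < 0" using less[of "n - 1"] \<open>n > 0\<close> by (simp add: of_nat_diff algebra_simps)
  then have z: "ht w (r - int n) r = 0"
    using n ht_first[of "r - int n" r w] sg_bounds[of "w (r - int n)"] \<open>n > 0\<close> by auto
  moreover have "ht w (r - int n) k > 0" if "r - int n \<le> k" "k < r" for k
  proof -
    have "nat (r - k - 1) < n" "r - int (nat (r - k - 1)) = k + 1" using that by auto
    then have "ht w (k + 1) r < 0" using less[of "nat (r - k - 1)"] by simp
    then show ?thesis using that z ht_split[of "r - int n" k r w] by simp
  qed
  ultimately have "(r - int n, r) \<in> matched w" using \<open>n > 0\<close> by (auto simp: matched_def)
  then show ?thesis by blast
qed

text \<open>A matched pair is a vee left of a wedge, so one of its ends lies in the finite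
  exceptional set; each vertex belongs to at most one pair in each role.\<close>

lemma finite_matched: "is_weight w \<Longrightarrow> finite (matched w)"
proof -
  assume "is_weight w"
  then obtain F where F: "finite F"
    "\<And>i j. i \<notin> F \<Longrightarrow> j \<notin> F \<Longrightarrow> i < j \<Longrightarrow> \<not> (w i = Dn \<and> w j = Up)"
    unfolding is_weight_def by blast
  have "matched w \<subseteq> {p \<in> matched w. fst p \<in> F} \<union> {p \<in> matched w. snd p \<in> F}"
  proof
    fix p assume p: "p \<in> matched w"
    then obtain i j where ij: "p = (i, j)" "(i, j) \<in> matched w" by (cases p) auto
    then have "i \<in> F \<or> j \<in> F"
      using F(2)[of i j] matched_less[OF ij(2)] matched_left[OF ij(2)] matched_right[OF ij(2)] by blast
    then show "p \<in> {p \<in> matched w. fst p \<in> F} \<union> {p \<in> matched w. snd p \<in> F}" using p ij by auto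
  qed
  moreover have "finite {p \<in> matched w. fst p \<in> F}"
  proof (rule finite_imageD)
    show "finite (fst ` {p \<in> matched w. fst p \<in> F})" using F(1) by (rule finite_subset[rotated]) auto
    show "inj_on fst {p \<in> matched w. fst p \<in> F}" by (auto simp: inj_on_def dest: matched_inj_left)
  qed
  moreover have "finite {p \<in> matched w. snd p \<in> F}"
  proof (rule finite_imageD)
    show "finite (snd ` {p \<in> matched w. snd p \<in> F})" using F(1) by (rule finite_subset[rotated]) auto
    show "inj_on snd {p \<in> matched w. snd p \<in> F}" by (auto simp: inj_on_def dest: matched_inj_right)
  qed
  ultimately show ?thesis by (meson finite_UnI finite_subset)
qed

lemma endsI: "(i, j) \<in> C \<Longrightarrow> i \<in> ends C" "(i, j) \<in> C \<Longrightarrow> j \<in> ends C"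
  by (force simp: ends_def)+

lemma endsE: "k \<in> ends C \<Longrightarrow> (\<And>j. (k, j) \<in> C \<Longrightarrow> P) \<Longrightarrow> (\<And>i. (i, k) \<in> C \<Longrightarrow> P) \<Longrightarrow> P"
  by (force simp: ends_def)

lemma finite_ends: "finite C \<Longrightarrow> finite (ends C)"
  by (simp add: ends_def)

definition mdiag :: "weight \<Rightarrow> diag" where
  "mdiag w = (matched w, {k. w k \<in> {Dn, Up}} - ends (matched w))"

lemma mdiag_cup_diagram:
  assumes "is_weight w"
  shows "cup_diagram (mdiag w)"
  unfolding cup_diagram_def
proof (intro conjI ballI)
  show "finite (fst (mdiag w))" using finite_matched[OF assms] by (simp add: mdiag_def)
next
  fix p assume "p \<in> fst (mdiag w)"
  then show "case p of (i, j) \<Rightarrow> i < j" by (auto simp: mdiag_def dest: matched_less)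
next
  fix p assume p: "p \<in> fst (mdiag w)"
  show "case p of (i, j) \<Rightarrow> \<forall>(k, l)\<in>fst (mdiag w). (i, j) \<noteq> (k, l) \<longrightarrow> i \<noteq> k \<and> i \<noteq> l \<and> j \<noteq> k \<and> j \<noteq> l"
  proof (clarify, goal_cases)
    case (1 i j k l)
    have ij: "(i, j) \<in> matched w" and kl: "(k, l) \<in> matched w" using p 1 by (auto simp: mdiag_def)
    have "i \<noteq> l" "j \<noteq> k"
      using matched_left[OF ij] matched_right[OF ij] matched_left[OF kl] matched_right[OF kl] by auto
    then show ?case
      using matched_inj_left[of i j w l] matched_inj_right[of i j w k] ij kl 1 by auto
  qed
next
  fix p assume p: "p \<in> fst (mdiag w)"
  show "case p of (i, j) \<Rightarrow> \<forall>(k, l)\<in>fst (mdiag w). \<not> (i < k \<and> k < j \<and> j < l)"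
    using p matched_noncrossing[of _ _ w] by (auto simp: mdiag_def)
next
  show "snd (mdiag w) \<inter> ends (fst (mdiag w)) = {}" by (auto simp: mdiag_def)
next
  fix p assume p: "p \<in> fst (mdiag w)"
  obtain i j where ij: "p = (i, j)" by force
  have m: "(i, j) \<in> matched w" using p ij by (simp add: mdiag_def)
  \<comment> \<open>Under a cup, a vee has negative height towards the right end and a wedge has
    positive height from the left end, so either one has a partner and is no ray.\<close>
  have False if r: "r \<in> snd (mdiag w)" "i < r" "r < j" for r
  proof -
    have nr: "r \<notin> ends (matched w)" and lr: "w r = Dn \<or> w r = Up" using r by (auto simp: mdiag_def)
    from lr show False
    proof
      assume "w r = Dn"
      then obtain l where "(r, l) \<in> matched w"
        using matched_from_left[of w r j] matched_suffix[OF m, of r] r by auto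
      then show False using nr by (auto dest: endsI)
    next
      assume "w r = Up"
      then obtain l where "(l, r) \<in> matched w"
        using matched_from_right[of w r i] matched_prefix[OF m, of r] r by auto
      then show False using nr by (auto dest: endsI)
    qed
  qed
  then show "case p of (i, j) \<Rightarrow> \<forall>r\<in>snd (mdiag w). \<not> (i < r \<and> r < j)" using ij by auto
qed

lemma mdiag_oriented: "oriented (mdiag w) w"
  unfolding oriented_def
proof (intro conjI ballI allI impI)
  fix k assume "k \<notin> ends (fst (mdiag w))" "k \<notin> snd (mdiag w)"
  then show "w k \<in> {Circ, Cross}" by (cases "w k") (auto simp: mdiag_def)
next
  fix p assume "p \<in> fst (mdiag w)"
  then show "case p of (i, j) \<Rightarrow> {w i, w j} = {Dn, Up}"
    by (auto simp: mdiag_def dest: matched_left matched_right)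
next
  fix k assume "k \<in> snd (mdiag w)"
  then show "w k \<in> {Dn, Up}" by (auto simp: mdiag_def)
next
  fix k l assume k: "k \<in> snd (mdiag w)" and l: "l \<in> snd (mdiag w)" and kl: "k < l"
  show "\<not> (w k = Dn \<and> w l = Up)"
  proof
    assume "w k = Dn \<and> w l = Up"
    \<comment> \<open>The sign of the height between the two decides which of them is
      matched.\<close>
    then show False
      using matched_from_left[of w k l] matched_from_right[of w l k] k l kl
      by (cases "ht w k l \<le> 0") (auto simp: mdiag_def dest: endsI)
  qed
qed

lemma mdiag_cdeg: "cdeg (mdiag w) w = 0"
proof -
  have "{p \<in> fst (mdiag w). w (fst p) = Up} = {}"
    using matched_left[of _ _ w] by (force simp: mdiag_def)
  then show ?thesis unfolding cdeg_def by (simp only: card.empty)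
qed

lemma oriented_nonfree: "oriented c w \<Longrightarrow> ends (fst c) \<union> snd c = {k. w k \<in> {Dn, Up}}"
proof (intro equalityI subsetI)
  fix k assume o: "oriented c w" and "k \<in> ends (fst c) \<union> snd c"
  then show "k \<in> {k. w k \<in> {Dn, Up}}"
    unfolding oriented_def by (fastforce elim!: endsE simp: doubleton_eq_iff)
next
  fix k assume o: "oriented c w" and "k \<in> {k. w k \<in> {Dn, Up}}"
  then show "k \<in> ends (fst c) \<union> snd c"
    unfolding oriented_def by auto
qed

lemma cup_diagramD:
  assumes "cup_diagram c"
  shows "finite (fst c)" "(i, j) \<in> fst c \<Longrightarrow> i < j"
    "(i, j) \<in> fst c \<Longrightarrow> (i, l) \<in> fst c \<Longrightarrow> j = l"
    "(i, j) \<in> fst c \<Longrightarrow> (k, j) \<in> fst c \<Longrightarrow> i = k"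
    "(i, j) \<in> fst c \<Longrightarrow> (j, k) \<in> fst c \<Longrightarrow> False"
    "(i, j) \<in> fst c \<Longrightarrow> (k, l) \<in> fst c \<Longrightarrow> i < k \<Longrightarrow> k < j \<Longrightarrow> l \<le> j"
    "snd c \<inter> ends (fst c) = {}"
    "(i, j) \<in> fst c \<Longrightarrow> r \<in> snd c \<Longrightarrow> i < r \<Longrightarrow> r < j \<Longrightarrow> False"
proof -
  show "finite (fst c)" "snd c \<inter> ends (fst c) = {}" using assms unfolding cup_diagram_def by simp_all
  have less: "i < j" if "(i, j) \<in> fst c" for i j using assms that unfolding cup_diagram_def by fast
  then show "(i, j) \<in> fst c \<Longrightarrow> i < j" .
  have disj: "(i, j) \<noteq> (k, l) \<longrightarrow> i \<noteq> k \<and> i \<noteq> l \<and> j \<noteq> k \<and> j \<noteq> l"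
    if "(i, j) \<in> fst c" "(k, l) \<in> fst c" for i j k l
    using assms that unfolding cup_diagram_def by fast
  show "(i, j) \<in> fst c \<Longrightarrow> (i, l) \<in> fst c \<Longrightarrow> j = l"
    "(i, j) \<in> fst c \<Longrightarrow> (k, j) \<in> fst c \<Longrightarrow> i = k"
    "(i, j) \<in> fst c \<Longrightarrow> (j, k) \<in> fst c \<Longrightarrow> False"
  proof -
    show "(i, j) \<in> fst c \<Longrightarrow> (i, l) \<in> fst c \<Longrightarrow> j = l" using disj by blast
    show "(i, j) \<in> fst c \<Longrightarrow> (k, j) \<in> fst c \<Longrightarrow> i = k" using disj by blast
    assume a: "(i, j) \<in> fst c" "(j, k) \<in> fst c"
    then show False using disj[OF a] less[OF a(1)] by blast
  qed
  show "(i, j) \<in> fst c \<Longrightarrow> r \<in> snd c \<Longrightarrow> i < r \<Longrightarrow> r < j \<Longrightarrow> False"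
    using assms unfolding cup_diagram_def by fast
  have "(i, j) \<in> fst c \<Longrightarrow> (k, l) \<in> fst c \<Longrightarrow> \<not> (i < k \<and> k < j \<and> j < l)"
    using assms unfolding cup_diagram_def by fast
  then show "(i, j) \<in> fst c \<Longrightarrow> (k, l) \<in> fst c \<Longrightarrow> i < k \<Longrightarrow> k < j \<Longrightarrow> l \<le> j"
    by force
qed

lemma orientedD:
  assumes "oriented c w"
  shows "(i, j) \<in> fst c \<Longrightarrow> {w i, w j} = {Dn, Up}"
    "k \<in> snd c \<Longrightarrow> w k \<in> {Dn, Up}"
    "k \<in> snd c \<Longrightarrow> l \<in> snd c \<Longrightarrow> k < l \<Longrightarrow> w k = Dn \<Longrightarrow> w l \<noteq> Up"
proof -
  show "(i, j) \<in> fst c \<Longrightarrow> {w i, w j} = {Dn, Up}"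
    using assms unfolding oriented_def by blast
  show "k \<in> snd c \<Longrightarrow> w k \<in> {Dn, Up}"
    using assms unfolding oriented_def by blast
  show "k \<in> snd c \<Longrightarrow> l \<in> snd c \<Longrightarrow> k < l \<Longrightarrow> w k = Dn \<Longrightarrow> w l \<noteq> Up"
    using assms unfolding oriented_def by blast
qed

section \<open>Uniqueness of the degree-zero cup diagram\<close>

lemma cdeg_zeroD: "cup_diagram c \<Longrightarrow> oriented c w \<Longrightarrow> cdeg c w = 0 \<Longrightarrow> (i, j) \<in> fst c \<Longrightarrow> w i = Dn \<and> w j = Up"
proof -
  assume a: "cup_diagram c" "oriented c w" "cdeg c w = 0" "(i, j) \<in> fst c"
  have "w i \<noteq> Up" using a(3,4) cup_diagramD(1)[OF a(1)] unfolding cdeg_def by auto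
  then show ?thesis using orientedD(1)[OF a(2,4)] by (auto simp: doubleton_eq_iff)
qed

text \<open>Under a cup there are no rays, and by noncrossing every cup with one end there has both
  ends there. Reading left to right, no cup closes before it opens, so heights stay positive until
  the outer cup closes.\<close>

lemma cups_matched:
  assumes c: "cup_diagram c" and o: "oriented c w" and z: "cdeg c w = 0"
  shows "fst c \<subseteq> matched w"
proof
  fix p assume "p \<in> fst c"
  then obtain i j where p: "p = (i, j)" and ij: "(i, j) \<in> fst c" by (cases p) auto
  note D = cup_diagramD[OF c]
  note lab = cdeg_zeroD[OF c o z]
  have less: "i < j" using D(2)[OF ij] .
  define Lf Rt where "Lf k = {p \<in> fst c. i < fst p \<and> fst p \<le> k}"
    and "Rt k = {p \<in> fst c. i < snd p \<and> snd p \<le> k}" for k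
  \<comment> \<open>The height gained after \<open>i\<close> is the number of cups opened minus the
    number of cups closed.\<close>
  have inner: "(\<Sum>m\<in>{i + 1..k}. sg (w m)) = int (card (Lf k)) - int (card (Rt k))" if k: "k < j" for k
  proof -
    have cover: "w m \<in> {Circ, Cross} \<or> m \<in> fst ` fst c \<or> m \<in> snd ` fst c" if "m \<in> {i + 1..k}" for m
    proof -
      have "m \<notin> snd c" using D(8)[OF ij, of m] that k by auto
      then show ?thesis using o unfolding oriented_def ends_def by blast
    qed
    have *: "{i+1..k} = ({i+1..k} \<inter> fst ` fst c) \<union> ({i+1..k} \<inter> snd ` fst c) \<union> ({i+1..k} - ends (fst c))"
      unfolding ends_def by auto
    have lr: "fst ` fst c \<inter> snd ` fst c = {}" using D(5) by fastforce
    have "(\<Sum>m\<in>{i + 1..k}. sg (w m)) = (\<Sum>m\<in>{i+1..k} \<inter> fst ` fst c. sg (w m)) + (\<Sum>m\<in>{i+1..k} \<inter> snd ` fst c. sg (w m))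
       + (\<Sum>m\<in>{i+1..k} - ends (fst c). sg (w m))"
      apply (subst *)
      apply (subst sum.union_disjoint)
         apply (use lr in \<open>auto simp: ends_def\<close>)
      apply (subst sum.union_disjoint)
         apply (use lr in \<open>auto simp: ends_def\<close>)
      done
    moreover have "(\<Sum>m\<in>{i+1..k} - ends (fst c). sg (w m)) = 0"
      by (rule sum.neutral) (use cover in \<open>fastforce simp: ends_def\<close>)
    moreover have "(\<Sum>m\<in>{i+1..k} \<inter> fst ` fst c. sg (w m)) = int (card ({i+1..k} \<inter> fst ` fst c))"
    proof -
      have "(\<Sum>m\<in>{i+1..k} \<inter> fst ` fst c. sg (w m)) = (\<Sum>m\<in>{i+1..k} \<inter> fst ` fst c. 1)"
        by (rule sum.cong) (use lab in auto)
      then show ?thesis by simp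
    qed
    moreover have "(\<Sum>m\<in>{i+1..k} \<inter> snd ` fst c. sg (w m)) = - int (card ({i+1..k} \<inter> snd ` fst c))"
    proof -
      have "(\<Sum>m\<in>{i+1..k} \<inter> snd ` fst c. sg (w m)) = (\<Sum>m\<in>{i+1..k} \<inter> snd ` fst c. - 1)"
        by (rule sum.cong) (use lab in auto)
      then show ?thesis by simp
    qed
    moreover have "{i+1..k} \<inter> fst ` fst c = fst ` Lf k" unfolding Lf_def by force
    moreover have "card (fst ` Lf k) = card (Lf k)"
      by (rule card_image) (auto simp: inj_on_def Lf_def dest: D(3))
    moreover have "{i+1..k} \<inter> snd ` fst c = snd ` Rt k" unfolding Rt_def by force
    moreover have "card (snd ` Rt k) = card (Rt k)"
      by (rule card_image) (auto simp: inj_on_def Rt_def dest: D(4))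
    ultimately show ?thesis by simp
  qed
  have fin: "finite (Lf k)" "finite (Rt k)" for k unfolding Lf_def Rt_def using D(1) by auto
  \<comment> \<open>A cup closed by \<open>k\<close> was opened after \<open>i\<close>, since
    otherwise it would cross the outer cup.\<close>
  have RL: "Rt k \<subseteq> Lf k" if "k < j" for k
  proof
    fix q assume "q \<in> Rt k"
    then obtain x y where q: "q = (x, y)" "(x, y) \<in> fst c" "i < y" "y \<le> k" by (cases q) (auto simp: Rt_def)
    have "x \<noteq> i" using D(3)[OF ij, of y] q that by auto
    moreover have "\<not> x < i" using D(6)[OF q(2) ij] q that by auto
    ultimately show "q \<in> Lf k" using q D(2)[OF q(2)] by (auto simp: Lf_def)
  qed
  \<comment> \<open>Conversely, just before \<open>j\<close> every inner cup has been
    closed.\<close>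
  have LR: "Lf (j - 1) \<subseteq> Rt (j - 1)"
  proof
    fix q assume "q \<in> Lf (j - 1)"
    then obtain x y where q: "q = (x, y)" "(x, y) \<in> fst c" "i < x" "x \<le> j - 1" by (cases q) (auto simp: Lf_def)
    have "y \<le> j" using D(6)[OF ij q(2)] q by auto
    moreover have "y \<noteq> j" using D(4)[OF ij, of x] q by auto
    ultimately show "q \<in> Rt (j - 1)" using q D(2)[OF q(2)] by (auto simp: Rt_def)
  qed
  have hi: "ht w i k = 1 + (\<Sum>m\<in>{i + 1..k}. sg (w m))" if "i \<le> k" for k
    using ht_first[of i k w] lab[OF ij] that by (cases "i = k") (auto simp: ht_def)
  have "ht w i k > 0" if "i \<le> k" "k < j" for k
    using hi[OF that(1)] inner[OF that(2)] card_mono[OF fin(1) RL[OF that(2)]] by linarith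
  moreover have "ht w i j = 0"
  proof -
    have "card (Lf (j - 1)) = card (Rt (j - 1))" using RL[of "j - 1"] LR by auto
    then have "ht w i (j - 1) = 1" using hi[of "j - 1"] inner[of "j - 1"] less by simp
    then show ?thesis using ht_last[OF less, of w] lab[OF ij] by simp
  qed
  ultimately show "p \<in> matched w" using less p by (auto simp: matched_def)
qed

text \<open>The cups of \<open>c\<close> are matched pairs. A matched pair missing from
  \<open>c\<close> could have neither end on a cup, so it would consist of two rays labelled vee,
  wedge in this order, which orientedness forbids.\<close>

lemma cup_diagram_eq_mdiag:
  assumes c: "cup_diagram c" and o: "oriented c w" and z: "cdeg c w = 0"
  shows "c = mdiag w"
proof -
  note sub = cups_matched[OF assms]
  note lab = cdeg_zeroD[OF assms]
  have "matched w \<subseteq> fst c"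
  proof
    fix p assume "p \<in> matched w"
    then obtain i j where p: "p = (i, j)" and ij: "(i, j) \<in> matched w" by (cases p) auto
    show "p \<in> fst c"
    proof (rule ccontr)
      assume n: "p \<notin> fst c"
      have "i \<notin> ends (fst c)"
        using n p sub matched_inj_left[OF ij] matched_left[OF ij] lab by (fastforce elim!: endsE)
      moreover have "j \<notin> ends (fst c)"
        using n p sub matched_inj_right[OF ij] matched_right[OF ij] lab by (fastforce elim!: endsE)
      ultimately have "i \<in> snd c" "j \<in> snd c"
        using oriented_nonfree[OF o] matched_left[OF ij] matched_right[OF ij] by auto
      then show False
        using orientedD(3)[OF o, of i j] matched_less[OF ij] matched_left[OF ij] matched_right[OF ij] by auto
    qed
  qed
  then have f: "fst c = matched w" using sub by auto
  have "snd c = {k. w k \<in> {Dn, Up}} - ends (matched w)"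
    using oriented_nonfree[OF o] cup_diagramD(7)[OF c] f by auto
  then show ?thesis using f unfolding mdiag_def by (metis prod.collapse)
qed

lemma lower_eqI:
  assumes "cup_diagram c" "oriented c w" "cdeg c w = 0"
  shows "lower w = c"
  unfolding lower_def
  by (rule the_equality) (use assms cup_diagram_eq_mdiag in blast)+

lemma lower_eq_mdiag: "is_weight w \<Longrightarrow> lower w = mdiag w"
  using lower_eqI mdiag_cup_diagram mdiag_oriented mdiag_cdeg by blast

lemma lower_props:
  assumes "is_weight w"
  shows "cup_diagram (lower w)" "oriented (lower w) w" "cdeg (lower w) w = 0"
  using lower_eq_mdiag[OF assms] mdiag_cup_diagram[OF assms] mdiag_oriented mdiag_cdeg by auto

section \<open>Components of the stacked diagram\<close>

definition component :: "('a \<times> 'a) set \<Rightarrow> 'a \<Rightarrow> 'a set" where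
  "component A k = (A \<union> A\<inverse>)\<^sup>* `` {k}"

definition saturated :: "('a \<times> 'a) set \<Rightarrow> 'a set \<Rightarrow> bool" where
  "saturated A X \<longleftrightarrow> (\<forall>(i, j)\<in>A. i \<in> X \<longleftrightarrow> j \<in> X)"

lemma saturatedD: "saturated A X \<Longrightarrow> (i, j) \<in> A \<Longrightarrow> i \<in> X \<longleftrightarrow> j \<in> X"
  by (auto simp: saturated_def)

lemma saturated_mono: "saturated B X \<Longrightarrow> A \<subseteq> B \<Longrightarrow> saturated A X"
  by (auto simp: saturated_def)

lemma component_self [simp]: "k \<in> component A k"
  by (simp add: component_def)

lemma component_saturated: "saturated A (component A k)"
  unfolding saturated_def component_def
proof clarify
  fix i j assume "(i, j) \<in> A"
  then have "(i, j) \<in> A \<union> A\<inverse>" "(j, i) \<in> A \<union> A\<inverse>" by auto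
  then show "i \<in> (A \<union> A\<inverse>)\<^sup>* `` {k} \<longleftrightarrow> j \<in> (A \<union> A\<inverse>)\<^sup>* `` {k}"
    by (meson Image_singleton_iff rtrancl.rtrancl_into_rtrancl)
qed

text \<open>The induction principle for connectivity: whatever passes along edges in both directions
  holds on the whole component.\<close>

lemma component_least:
  assumes "saturated A X" "k \<in> X"
  shows "component A k \<subseteq> X"
proof
  fix m assume "m \<in> component A k"
  then have "(k, m) \<in> (A \<union> A\<inverse>)\<^sup>*" by (simp add: component_def)
  then show "m \<in> X"
  proof induction
    case base then show ?case using assms by simp
  next
    case (step y z)
    then have "(y, z) \<in> A \<or> (z, y) \<in> A" by blast
    then show ?case using saturatedD[OF assms(1)] step by blast
  qed
qed

lemma component_eq: "m \<in> component A k \<Longrightarrow> component A m = component A k"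
proof -
  assume m: "m \<in> component A k"
  then have "(k, m) \<in> (A \<union> A\<inverse>)\<^sup>*" by (simp add: component_def)
  then have "(m, k) \<in> (A \<union> A\<inverse>)\<^sup>*"
    by (rule symD[OF sym_rtrancl[OF sym_Un_converse[of A]]])
  then have "k \<in> component A m" by (simp add: component_def)
  then have "component A k \<subseteq> component A m" by (rule component_least[OF component_saturated])
  moreover have "component A m \<subseteq> component A k" by (rule component_least[OF component_saturated m])
  ultimately show ?thesis by simp
qed

lemma component_mono: "A \<subseteq> B \<Longrightarrow> component A k \<subseteq> component B k"
  by (rule component_least[OF saturated_mono[OF component_saturated] component_self])

lemma component_insert_other:
  assumes "k \<notin> component (insert (i, j) A) i"
  shows "component A k = component (insert (i, j) A) k"
proof
  let ?B = "insert (i, j) A"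
  show "component A k \<subseteq> component ?B k" by (rule component_mono) auto
  have "i \<notin> component ?B k" "j \<notin> component ?B k"
  proof -
    show "i \<notin> component ?B k"
    proof
      assume "i \<in> component ?B k"
      then have "component ?B i = component ?B k" by (rule component_eq)
      then show False using assms component_self[of k ?B] by simp
    qed
    then show "j \<notin> component ?B k" using saturatedD[OF component_saturated[of ?B k], of i j] by simp
  qed
  then have "i \<notin> component A k" "j \<notin> component A k" using component_mono[of A ?B k] by auto
  then have "saturated ?B (component A k)" using component_saturated[of A k] by (auto simp: saturated_def)
  then show "component ?B k \<subseteq> component A k" by (rule component_least) simp
qed

text \<open>Read backwards, deleting an edge leaves the pieces around its two ends, which may
  coincide. Both effects of a surgery are covered by this one description.\<close>

lemma component_insert_split: "component (insert (i, j) A) i = component A i \<union> component A j"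
proof
  let ?B = "insert (i, j) A"
  have "saturated ?B (component A i \<union> component A j)"
    using saturatedD[OF component_saturated[of A i]] saturatedD[OF component_saturated[of A j]]
    unfolding saturated_def by (intro ballI) (force split: prod.split)
  then show "component ?B i \<subseteq> component A i \<union> component A j" by (rule component_least) simp
  have "j \<in> component ?B i" using saturatedD[OF component_saturated[of ?B i], of i j] by simp
  then have "component ?B j = component ?B i" by (rule component_eq)
  moreover have "component A i \<subseteq> component ?B i" "component A j \<subseteq> component ?B j" by (rule component_mono; blast)+
  ultimately show "component A i \<union> component A j \<subseteq> component ?B i" by simp
qed

lemma finite_component:
  assumes "finite A"
  shows "finite (component A k)"
proof -
  have "saturated A (insert k (fst ` A \<union> snd ` A))" by (force simp: saturated_def)
  then have "component A k \<subseteq> insert k (fst ` A \<union> snd ` A)" by (rule component_least) simp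
  then show ?thesis using assms by (auto intro: finite_subset)
qed

text \<open>Two vertices that are connected when directions are ignored have a common descendant, by
  confluence of a single-valued relation; a terminal vertex has only itself as a descendant.\<close>

lemma deterministic_terminal_unique:
  assumes F: "single_valued F" and xy: "(x, y) \<in> (F \<union> F\<inverse>)\<^sup>*" and "x \<notin> Domain F" "y \<notin> Domain F"
  shows "x = y"
proof -
  from xy have "\<exists>z. (x, z) \<in> F\<^sup>* \<and> (y, z) \<in> F\<^sup>*"
  proof induction
    case base then show ?case by blast
  next
    case (step y y')
    then obtain z where z: "(x, z) \<in> F\<^sup>*" "(y, z) \<in> F\<^sup>*" by blast
    show ?case
    proof (cases "(y, y') \<in> F")
      case True
      then have "(z, y') \<in> F\<^sup>* \<or> (y', z) \<in> F\<^sup>*"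
        using single_valued_confluent[OF F z(2), of y'] by blast
      then show ?thesis using z by (blast intro: rtrancl_trans)
    next
      case False
      then have "(y', y) \<in> F" using step by blast
      then show ?thesis using z by (blast intro: converse_rtrancl_into_rtrancl)
    qed
  qed
  then show ?thesis using assms(3,4) by (metis Not_Domain_rtrancl)
qed

definition matching :: "(int \<times> int) set \<Rightarrow> bool" where
  "matching m \<longleftrightarrow> (\<forall>p\<in>m. fst p \<noteq> snd p) \<and>
     (\<forall>p\<in>m. \<forall>q\<in>m. p \<noteq> q \<longrightarrow> {fst p, snd p} \<inter> {fst q, snd q} = {})"

lemma matching_subset: "matching m \<Longrightarrow> m' \<subseteq> m \<Longrightarrow> matching m'"
  unfolding matching_def by blast

lemma matching_partner:
  assumes "matching m" "(k, l) \<in> m \<or> (l, k) \<in> m" "(k, l') \<in> m \<or> (l', k) \<in> m"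
  shows "l = l'"
proof -
  have irr: "x \<noteq> y" if "(x, y) \<in> m" for x y using assms(1) that unfolding matching_def by fastforce
  have disj: "{x, y} \<inter> {u, v} = {}" if "(x, y) \<in> m" "(u, v) \<in> m" "(x, y) \<noteq> (u, v)" for x y u v
    using assms(1) that unfolding matching_def by fastforce
  from assms(2,3) show ?thesis
  proof (elim disjE)
    assume "(k, l) \<in> m" "(k, l') \<in> m"
    then show ?thesis using disj[of k l k l'] by auto
  next
    assume "(k, l) \<in> m" "(l', k) \<in> m"
    then show ?thesis using disj[of k l l' k] by auto
  next
    assume "(l, k) \<in> m" "(k, l') \<in> m"
    then show ?thesis using disj[of l k k l'] by auto
  next
    assume "(l, k) \<in> m" "(l', k) \<in> m"
    then show ?thesis using disj[of l k l' k] by auto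
  qed
qed

lemma cup_diagram_matching: "cup_diagram c \<Longrightarrow> matching (fst c)"
proof -
  assume c: "cup_diagram c"
  show ?thesis
    unfolding matching_def
  proof (intro conjI ballI impI)
    fix p assume "p \<in> fst c"
    then show "fst p \<noteq> snd p" using cup_diagramD(2)[OF c, of "fst p" "snd p"] by auto
  next
    fix p q assume pq: "p \<in> fst c" "q \<in> fst c" "p \<noteq> q"
    obtain i j k l where "p = (i, j)" "q = (k, l)" by (metis surj_pair)
    then show "{fst p, snd p} \<inter> {fst q, snd q} = {}"
      using pq cup_diagramD(3)[OF c, of i j l] cup_diagramD(4)[OF c, of i j k]
        cup_diagramD(5)[OF c, of i j l] cup_diagramD(5)[OF c, of k l j] by auto
  qed
qed

lemma opposite_sum: "{x, y} = {Dn, Up} \<Longrightarrow> sg x + sg y = 0"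
  by (auto simp: doubleton_eq_iff)

lemma sum_sg_ends:
  assumes "finite m" "matching m" "\<And>i j. (i, j) \<in> m \<Longrightarrow> {f i, f j} = {Dn, Up}"
  shows "(\<Sum>k\<in>ends m. sg (f k)) = 0"
proof -
  have e: "ends m = (\<Union>p\<in>m. {fst p, snd p})" by (force simp: ends_def)
  have "(\<Sum>k\<in>ends m. sg (f k)) = (\<Sum>p\<in>m. \<Sum>k\<in>{fst p, snd p}. sg (f k))"
    unfolding e by (rule sum.UNION_disjoint) (use assms(1,2) in \<open>auto simp: matching_def\<close>)
  also have "\<dots> = (\<Sum>p\<in>m. 0)"
  proof (rule sum.cong[OF refl])
    fix p assume p: "p \<in> m"
    then have "fst p \<noteq> snd p" using assms(2) by (auto simp: matching_def)
    then show "(\<Sum>k\<in>{fst p, snd p}. sg (f k)) = 0"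
      using opposite_sum[OF assms(3)[of "fst p" "snd p"]] p by simp
  qed
  finally show ?thesis by simp
qed

text \<open>The substitute for topology: a set made of whole arcs contains equally many vees and
  wedges among the arc ends.\<close>

lemma sum_sg_saturated:
  assumes "finite m" "matching m" "\<And>i j. (i, j) \<in> m \<Longrightarrow> {f i, f j} = {Dn, Up}"
    and "saturated m X"
  shows "(\<Sum>k\<in>X \<inter> ends m. sg (f k)) = 0"
proof -
  let ?m = "{p \<in> m. fst p \<in> X}"
  have "X \<inter> ends m = ends ?m"
    using assms(4) by (fastforce simp: ends_def saturated_def)
  moreover have "(\<Sum>k\<in>ends ?m. sg (f k)) = 0"
    by (rule sum_sg_ends) (use assms matching_subset[of m ?m] in auto)
  ultimately show ?thesis by simp
qed

lemma sum_sg_const: "finite A \<Longrightarrow> s \<in> {Dn, Up} \<Longrightarrow> (\<And>k. k \<in> A \<Longrightarrow> f k = s) \<Longrightarrow> (\<Sum>k\<in>A. sg (f k)) = 0 \<Longrightarrow> A = {}"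
  by auto

lemma swap_opposite: "{x, y} = {Dn, Up} \<Longrightarrow> {swap x, swap y} = {Dn, Up}"
  by (auto simp: doubleton_eq_iff)

lemma swap_in [simp]: "swap x \<in> {Dn, Up} \<longleftrightarrow> x \<in> {Dn, Up}"
  by (cases x) auto

lemma swap_swap [simp]: "swap (swap x) = x"
  by (cases x) auto

section \<open>The two-level diagram, its circle types and the choice made in reorientation\<close>

definition vset :: "diag \<Rightarrow> (int \<times> int) set \<Rightarrow> int set" where
  "vset b R = (ends (fst b) - ends R) \<union> snd b"

lemma type1_both: "finite X \<Longrightarrow> X \<noteq> {} \<Longrightarrow> type1 L (UNIV \<times> X) \<longleftrightarrow> L (False, Min X) = Dn"
  by (simp add: type1_def Let_def)

lemma type1_one: "finite X \<Longrightarrow> X \<noteq> {} \<Longrightarrow> type1 L ({h} \<times> X) \<longleftrightarrow> L (h, Min X) = Dn"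
  by (cases h) (simp_all add: type1_def Let_def)

lemma is_line_both: "is_line a a (UNIV \<times> X) \<longleftrightarrow> X \<inter> snd a \<noteq> {}"
  by (auto simp: is_line_def rayend_def)

lemma is_line_one: "is_line a a ({h} \<times> X) \<longleftrightarrow> X \<inter> snd a \<noteq> {}"
  by (auto simp: is_line_def rayend_def)

text \<open>Replaces the unspecified choice by the properties every candidate has. Uniqueness of the
  candidate is not claimed; its prescribed types alone decide goodness.\<close>

lemma reorient_cases:
  obtains (zero) "reorient a b d R L C spec = (\<lambda>_. 0)"
  | (single) M where "reorient a b d R L C spec = single M" "consistent a b d R M"
      "\<And>n. n \<notin> C \<or> rayend a d n \<Longrightarrow> M n = L n" "spec M"
proof (cases "\<exists>L'. consistent a b d R L' \<and> (\<forall>n. n \<notin> C \<or> rayend a d n \<longrightarrow> L' n = L n) \<and> spec L'")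
  case True
  define M where "M = (SOME L'. consistent a b d R L' \<and> (\<forall>n. n \<notin> C \<or> rayend a d n \<longrightarrow> L' n = L n) \<and> spec L')"
  have "consistent a b d R M \<and> (\<forall>n. n \<notin> C \<or> rayend a d n \<longrightarrow> M n = L n) \<and> spec M"
    unfolding M_def by (rule someI_ex[OF True])
  moreover have "reorient a b d R L C spec = single M"
    unfolding reorient_def M_def by (rule if_P[OF True])
  ultimately show ?thesis by (blast intro: that(2))
next
  case False
  then have "reorient a b d R L C spec = (\<lambda>_. 0)" unfolding reorient_def by (rule if_not_P)
  then show ?thesis by (rule that(1))
qed

lemma reorient_exists:
  assumes "consistent a b d R L'" "\<And>n. n \<notin> C \<or> rayend a d n \<Longrightarrow> L' n = L n" "spec L'"
  obtains M where "reorient a b d R L C spec = single M" "consistent a b d R M"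
      "\<And>n. n \<notin> C \<or> rayend a d n \<Longrightarrow> M n = L n" "spec M"
proof -
  have True: "\<exists>L'. consistent a b d R L' \<and> (\<forall>n. n \<notin> C \<or> rayend a d n \<longrightarrow> L' n = L n) \<and> spec L'"
    using assms by blast
  define M where "M = (SOME L'. consistent a b d R L' \<and> (\<forall>n. n \<notin> C \<or> rayend a d n \<longrightarrow> L' n = L n) \<and> spec L')"
  have "consistent a b d R M \<and> (\<forall>n. n \<notin> C \<or> rayend a d n \<longrightarrow> M n = L n) \<and> spec M"
    unfolding M_def by (rule someI_ex[OF True])
  moreover have "reorient a b d R L C spec = single M"
    unfolding reorient_def M_def by (rule if_P[OF True])
  ultimately show ?thesis by (blast intro: that)
qed

text \<open>The stack of \<open>(a \<lambda> b)\<close> below \<open>(b \<mu> a)\<close>, whose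
  outer diagrams agree, so that it is its own mirror image. \<open>L0\<close> is the initial
  labelling and \<open>s\<close> the label common to all rays.\<close>

locale stack =
  fixes a b :: diag and s :: lab and L0 :: lbl
  assumes fin_a: "finite (fst a)" and fin_b: "finite (fst b)"
    and match_a: "matching (fst a)" and match_b: "matching (fst b)"
    and disj_a: "snd a \<inter> ends (fst a) = {}" and disj_b: "snd b \<inter> ends (fst b) = {}"
    and same_support: "ends (fst a) \<union> snd a = ends (fst b) \<union> snd b"
    and L0_consistent: "consistent a b a (fst b) L0"
    and L0_rays_a: "k \<in> snd a \<Longrightarrow> L0 (h, k) = s"
    and L0_rays_b: "k \<in> snd b \<Longrightarrow> L0 (h, k) = s"
    and s_label: "s \<in> {Dn, Up}"
begin

definition V :: "int set" where "V = ends (fst a) \<union> snd a"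

text \<open>Both number lines carry the same arcs, so one graph on the integers describes both
  levels at once.\<close>

definition gr :: "(int \<times> int) set \<Rightarrow> (int \<times> int) set" where "gr R = fst a \<union> R"

text \<open>Rays and free vertices keep their initial labels throughout; recording this here lets
  the final weight be compared with the initial one at every vertex.\<close>

definition adm :: "(int \<times> int) set \<Rightarrow> lbl \<Rightarrow> bool" where
  "adm R L \<longleftrightarrow> consistent a b a R L \<and> (\<forall>n. snd n \<notin> ends (fst a) \<longrightarrow> L n = L0 n)"

definition cut :: "(int \<times> int) set \<Rightarrow> int \<Rightarrow> bool" where
  "cut R k \<longleftrightarrow> component (gr R) k \<inter> vset b R \<noteq> {}"

text \<open>Lines impose no condition. For a symmetric circle the lower copy of the leftmost vertex
  is the one that \<open>type1\<close> inspects; for a mirror pair each level has its own leftmost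
  vertex.\<close>

definition cond :: "(int \<times> int) set \<Rightarrow> lbl \<Rightarrow> int \<Rightarrow> bool" where
  "cond R L k \<longleftrightarrow>
     (let X = component (gr R) k in
      if cut R k then X \<inter> snd a \<noteq> {} \<or> L (False, Min X) \<noteq> Dn
      else (L (False, Min X) = Dn) \<noteq> (L (True, Min X) = Dn))"

definition good :: "(int \<times> int) set \<Rightarrow> lbl \<Rightarrow> bool" where
  "good R L \<longleftrightarrow> (\<forall>k\<in>V. cond R L k)"

lemma consistent_iff:
  "consistent a b a R L \<longleftrightarrow>
     (\<forall>h i j. (i, j) \<in> gr R \<longrightarrow> {L (h, i), L (h, j)} = {Dn, Up}) \<and>
     (\<forall>k\<in>vset b R. L (False, k) = L (True, k) \<and> L (False, k) \<in> {Dn, Up})"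
  (is "?l \<longleftrightarrow> ?r")
proof -
  have A: "arcs a a R = {((h, i), (h, j)) | h i j. (i, j) \<in> gr R}" (is "_ = ?A")
  proof (rule set_eqI)
    fix q :: "node \<times> node"
    obtain h i h' j where "q = ((h, i), (h', j))" by (metis surj_pair)
    then show "q \<in> arcs a a R \<longleftrightarrow> q \<in> ?A"
      unfolding arcs_def gr_def by (cases h; cases h') auto
  qed
  have B: "verts b R = {((False, k), (True, k)) | k. k \<in> vset b R}"
    by (simp add: verts_def vset_def)
  show ?thesis unfolding consistent_def A B
    by (intro arg_cong2[where f = "(\<and>)"]) (simp_all only: Ball_def mem_Collect_eq case_prod_unfold, force+)
qed

lemma saturated_gr_V: "R \<subseteq> fst b \<Longrightarrow> saturated (gr R) V"
proof -
  assume R: "R \<subseteq> fst b"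
  have "i \<in> V \<and> j \<in> V" if "(i, j) \<in> gr R" for i j
    using that R same_support endsI[of i j] unfolding gr_def V_def by blast
  then show ?thesis unfolding saturated_def by blast
qed

lemma component_V: "R \<subseteq> fst b \<Longrightarrow> k \<in> V \<Longrightarrow> component (gr R) k \<subseteq> V"
  by (rule component_least[OF saturated_gr_V])

lemma finite_gr_comp: "R \<subseteq> fst b \<Longrightarrow> finite (component (gr R) k)"
  by (rule finite_component) (simp add: gr_def fin_a finite_subset[OF _ fin_b])

lemma gr_comp_nonempty: "component (gr R) k \<noteq> {}"
  using component_self[of k "gr R"] by blast

lemma adm_arc: "adm R L \<Longrightarrow> (i, j) \<in> gr R \<Longrightarrow> {L (h, i), L (h, j)} = {Dn, Up}"
  and adm_vert: "adm R L \<Longrightarrow> k \<in> vset b R \<Longrightarrow> L (False, k) = L (True, k)"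
  and adm_fixed: "adm R L \<Longrightarrow> k \<notin> ends (fst a) \<Longrightarrow> L (h, k) = L0 (h, k)"
  unfolding adm_def consistent_iff by auto

lemma adm_vert_label: "adm R L \<Longrightarrow> k \<in> vset b R \<Longrightarrow> L (False, k) = L (True, k) \<and> L (False, k) \<in> {Dn, Up}"
  unfolding adm_def consistent_iff by blast

lemma adm_ray: "adm R L \<Longrightarrow> k \<in> snd a \<Longrightarrow> L (h, k) = s"
  using adm_fixed[of R L k h] L0_rays_a disj_a by auto

lemma adm_label: "adm R L \<Longrightarrow> k \<in> V \<Longrightarrow> L (h, k) \<in> {Dn, Up}"
proof -
  assume L: "adm R L" and k: "k \<in> V"
  show ?thesis
  proof (cases "k \<in> snd a")
    case True then show ?thesis using adm_ray[OF L True] s_label by simp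
  next
    case False
    then have "k \<in> ends (fst a)" using k by (auto simp: V_def)
    then obtain j where "(k, j) \<in> fst a \<or> (j, k) \<in> fst a" by (auto elim: endsE)
    then show ?thesis using adm_arc[OF L, of k j h] adm_arc[OF L, of j k h]
      by (auto simp: gr_def doubleton_eq_iff)
  qed
qed

lemma scomp_alt: "scomp a b a R n = component (arcs a a R \<union> verts b R) n"
  by (auto simp: scomp_def sconn_def component_def)

lemma arcs_iff: "((h, i), (h', j)) \<in> arcs a a R \<longleftrightarrow> h = h' \<and> (i, j) \<in> gr R"
  unfolding arcs_def gr_def by (cases h; cases h') auto

lemma verts_iff: "((h, i), (h', j)) \<in> verts b R \<longleftrightarrow> \<not> h \<and> h' \<and> i = j \<and> i \<in> vset b R"
  unfolding verts_def vset_def by auto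

lemma scomp_level: "{h} \<times> component (gr R) k \<subseteq> scomp a b a R (h, k)"
proof -
  have "saturated (gr R) {m. (h, m) \<in> scomp a b a R (h, k)}"
    using component_saturated[of "arcs a a R \<union> verts b R" "(h, k)"] arcs_iff[of h _ h _ R]
    unfolding saturated_def scomp_alt by fastforce
  then have "component (gr R) k \<subseteq> {m. (h, m) \<in> scomp a b a R (h, k)}"
    by (rule component_least) (simp add: scomp_alt)
  then show ?thesis by auto
qed

lemma scomp_uncut: "\<not> cut R k \<Longrightarrow> scomp a b a R (h, k) = {h} \<times> component (gr R) k"
proof
  assume u: "\<not> cut R k"
  have "saturated (arcs a a R \<union> verts b R) ({h} \<times> component (gr R) k)"
    using component_saturated[of "gr R" k] u
    unfolding saturated_def by (auto simp: arcs_iff verts_iff cut_def)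
  then show "scomp a b a R (h, k) \<subseteq> {h} \<times> component (gr R) k"
    unfolding scomp_alt by (rule component_least) simp
qed (rule scomp_level)

text \<open>A single vertical segment suffices: beyond it lies the same component on the other
  level.\<close>

lemma scomp_cut: "cut R k \<Longrightarrow> scomp a b a R (h, k) = UNIV \<times> component (gr R) k"
proof
  assume c: "cut R k"
  have "saturated (arcs a a R \<union> verts b R) (UNIV \<times> component (gr R) k)"
    using component_saturated[of "gr R" k]
    unfolding saturated_def by (auto simp: arcs_iff verts_iff)
  then show "scomp a b a R (h, k) \<subseteq> UNIV \<times> component (gr R) k"
    unfolding scomp_alt by (rule component_least) simp
  obtain m where m: "m \<in> component (gr R) k" "m \<in> vset b R" using c by (auto simp: cut_def)
  have "(h, m) \<in> scomp a b a R (h, k)" using scomp_level m by fastforce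
  then have "(h', m) \<in> scomp a b a R (h, k)" for h'
    using saturatedD[OF component_saturated, of "(False, m)" "(True, m)" "arcs a a R \<union> verts b R" "(h, k)"]
      m(2) unfolding scomp_alt by (cases h; cases h') (auto simp: verts_iff)
  then have "scomp a b a R (h', m) = scomp a b a R (h, k)" for h'
    unfolding scomp_alt by (rule component_eq)
  then have "{h'} \<times> component (gr R) m \<subseteq> scomp a b a R (h, k)" for h'
    using scomp_level[of h' R m] by metis
  then show "UNIV \<times> component (gr R) k \<subseteq> scomp a b a R (h, k)"
    using component_eq[OF m(1)] by auto
qed

text \<open>The levels agree at a vertical segment, and labels alternate along the arcs of both
  levels, so the agreement spreads.\<close>

lemma cut_levels_agree:
  assumes "adm R L" "cut R k" "m \<in> component (gr R) k"
  shows "L (True, m) = L (False, m)"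
proof -
  obtain v where v: "v \<in> component (gr R) k" "v \<in> vset b R" using assms(2) by (auto simp: cut_def)
  let ?X = "{m. L (True, m) = L (False, m)}"
  have "saturated (gr R) ?X"
    unfolding saturated_def
  proof clarify
    fix i j assume "(i, j) \<in> gr R"
    then show "i \<in> ?X \<longleftrightarrow> j \<in> ?X"
      using adm_arc[OF assms(1), of i j True] adm_arc[OF assms(1), of i j False]
      by (auto simp: doubleton_eq_iff)
  qed
  moreover have "v \<in> ?X" using adm_vert[OF assms(1) v(2)] by simp
  ultimately have "component (gr R) v \<subseteq> ?X" by (rule component_least)
  then show ?thesis using assms(3) component_eq[OF v(1)] by auto
qed

text \<open>Double counting of the labels of \<open>X\<close>: cancelling the arcs of
  \<open>a\<close> leaves the rays of \<open>a\<close>, cancelling the arcs of \<open>R\<close>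
  leaves the vertices off \<open>R\<close>.\<close>

lemma balance:
  assumes L: "adm R L" and R: "R \<subseteq> fst b" and X: "saturated (gr R) X" "finite X" "X \<subseteq> V"
  shows "(\<Sum>k\<in>X \<inter> snd a. sg (L (h, k))) = (\<Sum>k\<in>X - ends R. sg (L (h, k)))"
proof -
  have "(\<Sum>k\<in>X. sg (L (h, k))) = (\<Sum>k\<in>X \<inter> ends (fst a). sg (L (h, k))) + (\<Sum>k\<in>X \<inter> snd a. sg (L (h, k)))"
  proof (subst sum.union_disjoint[symmetric])
    have "X = X \<inter> ends (fst a) \<union> X \<inter> snd a" using X(3) by (auto simp: V_def)
    then show "(\<Sum>k\<in>X. sg (L (h, k))) = (\<Sum>k\<in>X \<inter> ends (fst a) \<union> X \<inter> snd a. sg (L (h, k)))" by simp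
  qed (use X(2) disj_a in auto)
  moreover have "(\<Sum>k\<in>X \<inter> ends (fst a). sg (L (h, k))) = 0"
    by (rule sum_sg_saturated)
      (use fin_a match_a adm_arc[OF L] saturated_mono[OF X(1)] in \<open>auto simp: gr_def\<close>)
  moreover have "(\<Sum>k\<in>X. sg (L (h, k))) = (\<Sum>k\<in>X \<inter> ends R. sg (L (h, k))) + (\<Sum>k\<in>X - ends R. sg (L (h, k)))"
    using sum.Int_Diff[OF X(2)] by blast
  moreover have "(\<Sum>k\<in>X \<inter> ends R. sg (L (h, k))) = 0"
    by (rule sum_sg_saturated)
      (use finite_subset[OF R fin_b] matching_subset[OF match_b R] adm_arc[OF L] saturated_mono[OF X(1)] in \<open>auto simp: gr_def\<close>)
  ultimately show ?thesis by simp
qed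

lemma uncut_subset_ends:
  assumes "R \<subseteq> fst b" "k \<in> V" "\<not> cut R k"
  shows "component (gr R) k \<subseteq> ends R"
  using component_V[OF assms(1,2)] assms(3) same_support unfolding cut_def vset_def V_def by auto

text \<open>Such a component has no vertex off \<open>R\<close>, so by \<open>balance\<close> its
  rays have signed count 0; as they share one label, there are none. Hence a surgery only ever
  merges circles, never lines.\<close>

lemma uncut_no_ray:
  assumes "adm R L" "R \<subseteq> fst b" "k \<in> V" "\<not> cut R k"
  shows "component (gr R) k \<inter> snd a = {}"
proof (rule sum_sg_const)
  show "(\<Sum>m\<in>component (gr R) k \<inter> snd a. sg (L (False, m))) = 0"
  proof -
    have e: "component (gr R) k - ends R = {}" using uncut_subset_ends[OF assms(2-4)] by blast
    show ?thesis
      unfolding balance[OF assms(1,2) component_saturated finite_gr_comp[OF assms(2)] component_V[OF assms(2,3)]] e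
      by simp
  qed
  show "finite (component (gr R) k \<inter> snd a)" using finite_gr_comp[OF assms(2)] by simp
qed (use s_label adm_ray[OF assms(1)] in auto)

text \<open>Leaving a vertex labelled \<open>s\<close> along \<open>a\<close> and any other vertex along \<open>R\<close> is a deterministic walk
  which traverses every edge. Rays of \<open>a\<close> and vertices off \<open>R\<close> labelled differently from \<open>s\<close> are
  terminal for it, and a component contains at most one terminal vertex.\<close>
lemma terminal_unique:
  assumes L: "adm R L" and R: "R \<subseteq> fst b"
    and x: "x \<in> snd a" and y: "L (False, y) \<noteq> s" "y \<notin> ends R"
  shows "x \<notin> component (gr R) y"
proof
  assume xy: "x \<in> component (gr R) y"
  define F where "F = {(k, l). (L (False, k) = s \<and> ((k, l) \<in> fst a \<or> (l, k) \<in> fst a)) \<or>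
      (L (False, k) \<noteq> s \<and> ((k, l) \<in> R \<or> (l, k) \<in> R))}"
  have "single_valued F"
  proof (rule single_valuedI)
    fix k l l' assume *: "(k, l) \<in> F" "(k, l') \<in> F"
    show "l = l'"
    proof (cases "L (False, k) = s")
      case True
      then show ?thesis using * matching_partner[OF match_a, of k l l'] by (simp add: F_def)
    next
      case False
      then show ?thesis using * matching_partner[OF matching_subset[OF match_b R], of k l l'] by (simp add: F_def)
    qed
  qed
  moreover have "(y, x) \<in> (F \<union> F\<inverse>)\<^sup>*"
  proof -
    have *: "(k, l) \<in> F \<union> F\<inverse>" if "(k, l) \<in> gr R" for k l
      using adm_arc[OF L that, of False] that s_label by (auto simp: F_def gr_def doubleton_eq_iff)
    have "gr R \<union> (gr R)\<inverse> \<subseteq> F \<union> F\<inverse>"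
    proof
      fix q assume "q \<in> gr R \<union> (gr R)\<inverse>"
      then obtain k l where "q = (k, l)" "(k, l) \<in> gr R \<or> (l, k) \<in> gr R" by (cases q) auto
      then show "q \<in> F \<union> F\<inverse>" using *[of k l] *[of l k] by auto
    qed
    then have "(gr R \<union> (gr R)\<inverse>)\<^sup>* \<subseteq> (F \<union> F\<inverse>)\<^sup>*" by (rule rtrancl_mono)
    moreover have "(y, x) \<in> (gr R \<union> (gr R)\<inverse>)\<^sup>*" using xy by (simp add: component_def)
    ultimately show ?thesis by (rule subsetD)
  qed
  moreover have "x \<notin> Domain F" using adm_ray[OF L x, of False] x disj_a by (auto simp: F_def dest: endsI)
  moreover have "y \<notin> Domain F" using y by (auto simp: F_def dest: endsI)
  ultimately have "y = x" using deterministic_terminal_unique by metis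
  then show False using y adm_ray[OF L x, of False] by simp
qed

lemma cond_cong: "component (gr R) k = component (gr R) m \<Longrightarrow> cond R L k = cond R L m"
  by (simp add: cond_def cut_def)

text \<open>The invariant of the run: \<open>t\<close> is the number of good orientations in
  \<open>g\<close> weighted by coefficients. Finite support and admissibility travel along because
  the next surgery relies on them.\<close>

definition evaluates :: "(lbl \<Rightarrow> complex) \<Rightarrow> (int \<times> int) set \<Rightarrow> complex \<Rightarrow> bool" where
  "evaluates g R t \<longleftrightarrow> finite {M. g M \<noteq> 0} \<and> (\<forall>M. g M \<noteq> 0 \<longrightarrow> adm R M) \<and>
     (\<Sum>M\<in>{M. g M \<noteq> 0}. g M * of_bool (good R M)) = t"

lemma evaluates_zero: "evaluates (\<lambda>_. 0) R 0"
  by (simp add: evaluates_def)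

lemma evaluates_single:
  assumes "adm R M"
  shows "evaluates (single M) R (of_bool (good R M))"
proof -
  have "{N. single M N \<noteq> 0} = {M}" by (auto simp: single_def)
  then show ?thesis using assms by (auto simp: evaluates_def single_def)
qed

lemma evaluates_add:
  assumes "evaluates g R t" "evaluates g' R t'"
  shows "evaluates (\<lambda>M. g M + g' M) R (t + t')"
proof -
  \<comment> \<open>Coefficients may cancel in the sum, so everything is summed over the union of
    the two supports.\<close>
  let ?S = "{M. g M \<noteq> 0} \<union> {M. g' M \<noteq> 0}"
  have fin: "finite ?S" using assms by (simp add: evaluates_def)
  have sub: "{M. g M + g' M \<noteq> 0} \<subseteq> ?S" by auto
  have "(\<Sum>M\<in>{M. g M + g' M \<noteq> 0}. (g M + g' M) * of_bool (good R M)) = (\<Sum>M\<in>?S. (g M + g' M) * of_bool (good R M))"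
    by (rule sum.mono_neutral_left[OF fin sub]) auto
  also have "\<dots> = (\<Sum>M\<in>?S. g M * of_bool (good R M)) + (\<Sum>M\<in>?S. g' M * of_bool (good R M))"
    by (simp add: algebra_simps sum.distrib)
  also have "(\<Sum>M\<in>?S. g M * of_bool (good R M)) = t"
    using assms(1) sum.mono_neutral_left[of ?S "{M. g M \<noteq> 0}" "\<lambda>M. g M * of_bool (good R M)"] fin
    by (auto simp: evaluates_def)
  also have "(\<Sum>M\<in>?S. g' M * of_bool (good R M)) = t'"
    using assms(2) sum.mono_neutral_left[of ?S "{M. g' M \<noteq> 0}" "\<lambda>M. g' M * of_bool (good R M)"] fin
    by (auto simp: evaluates_def)
  finally have "(\<Sum>M\<in>{M. g M + g' M \<noteq> 0}. (g M + g' M) * of_bool (good R M)) = t + t'" .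
  moreover have "adm R M" if "g M + g' M \<noteq> 0" for M
    using assms that unfolding evaluates_def by (cases "g M = 0") auto
  ultimately show ?thesis using finite_subset[OF sub fin] unfolding evaluates_def by blast
qed

end

section \<open>Surgery and the counting invariant\<close>

locale surgery = stack +
  fixes R :: "(int \<times> int) set" and i j :: int and L :: lbl
  assumes R: "R \<subseteq> fst b" and p: "(i, j) \<in> R" and L: "adm R L"
begin

definition R' :: "(int \<times> int) set" where "R' = R - {(i, j)}"
text \<open>\<open>X\<close> is the component about to be cut, \<open>X1\<close> and
  \<open>X2\<close> are what remains around the two ends of the removed cap; they may be
  equal.\<close>

definition X :: "int set" where "X = component (gr R) i"
definition X1 :: "int set" where "X1 = component (gr R') i"
definition X2 :: "int set" where "X2 = component (gr R') j"

lemma R': "R' \<subseteq> fst b" and R'_R: "R' \<subseteq> R"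
  using R by (auto simp: R'_def)

lemma gr_R: "gr R = insert (i, j) (gr R')"
  using p by (auto simp: gr_def R'_def)

text \<open>Distinct caps share no vertex. Both ends of the removed cap therefore become places of
  vertical segments, and the pieces around them are symmetric.\<close>

lemma not_ends_R': "i \<notin> ends R'" "j \<notin> ends R'"
proof -
  have m: "matching R" using matching_subset[OF match_b R] .
  have ij: "i \<noteq> j" using m p by (auto simp: matching_def)
  have ji: "(j, i) \<notin> R"
  proof
    assume "(j, i) \<in> R"
    then have "{i, j} \<inter> {j, i} = {}" using m p ij unfolding matching_def by fastforce
    then show False by blast
  qed
  have *: False if "k \<in> {i, j}" "(k, l) \<in> R' \<or> (l, k) \<in> R'" for k l
    using that matching_partner[OF m, of k l "if k = i then j else i"] p ij ji
    by (auto simp: R'_def)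
  show "i \<notin> ends R'" "j \<notin> ends R'"
    using *[of i] *[of j] by (auto elim!: endsE)
qed

lemma ends_R: "ends R = insert i (insert j (ends R'))"
  using p by (auto simp: ends_def R'_def image_iff) force+

lemma ij_b: "i \<in> ends (fst b)" "j \<in> ends (fst b)"
  using endsI[of i j "fst b"] p R by auto

lemma ij_V: "i \<in> V" "j \<in> V"
  using ij_b same_support by (auto simp: V_def)

lemma vset_R': "vset b R' = insert i (insert j (vset b R))"
  using ij_b not_ends_R' unfolding vset_def ends_R by auto

lemma X_split: "X = X1 \<union> X2"
  unfolding X_def X1_def X2_def gr_R by (rule component_insert_split)

lemma X_sat: "saturated (gr R) X" "saturated (gr R') X1" "saturated (gr R') X2" "saturated (gr R') X"
  unfolding X_def X1_def X2_def
  by (rule component_saturated saturated_mono[OF component_saturated] | simp add: gr_R subset_insertI)+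

lemma X_fin: "finite X" "finite X1" "finite X2"
  unfolding X_def X1_def X2_def by (simp_all add: finite_gr_comp R R')

lemma X_V: "X \<subseteq> V"
  unfolding X_def by (rule component_V[OF R ij_V(1)])

lemma ij_X: "i \<in> X1" "j \<in> X2" "i \<in> X" "j \<in> X"
  unfolding X_split by (simp_all add: X1_def X2_def)

lemma X_ne: "X \<noteq> {}" "X1 \<noteq> {}" "X2 \<noteq> {}"
  using ij_X by auto

lemma in_X: "k \<in> X \<Longrightarrow> component (gr R) k = X"
  and in_X1: "k \<in> X1 \<Longrightarrow> component (gr R') k = X1"
  and in_X2: "k \<in> X2 \<Longrightarrow> component (gr R') k = X2"
  unfolding X_def X1_def X2_def by (rule component_eq; assumption)+

lemma notin_X: "k \<notin> X \<Longrightarrow> component (gr R') k = component (gr R) k"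
  unfolding X_def gr_R by (rule component_insert_other)

lemma notin_X_cut: "k \<notin> X \<Longrightarrow> cut R' k = cut R k"
proof -
  assume k: "k \<notin> X"
  have "i \<notin> component (gr R) k" "j \<notin> component (gr R) k"
    using component_eq[of i "gr R" k] component_eq[of j "gr R" k] in_X[of i] in_X[of j] ij_X k
      component_self[of k "gr R"] by auto
  then show ?thesis using notin_X[OF k] vset_R' by (simp add: cut_def)
qed

lemma cut_R': "cut R' i" "cut R' j"
  using vset_R' by (auto simp: cut_def component_self intro!: exI[of _ i] exI[of _ j])

text \<open>The candidates from which \<open>reorient\<close> chooses, before the prescribed types
  are imposed.\<close>

definition valid :: "lbl \<Rightarrow> bool" where
  "valid M \<longleftrightarrow> consistent a b a R' M \<and> (\<forall>n. n \<notin> UNIV \<times> X \<or> rayend a a n \<longrightarrow> M n = L n)"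

lemma valid_fixed: "valid M \<Longrightarrow> n \<notin> UNIV \<times> X \<or> rayend a a n \<Longrightarrow> M n = L n"
  unfolding valid_def by blast

lemma valid_adm: "valid M \<Longrightarrow> adm R' M"
proof -
  assume M: "valid M"
  have "M n = L0 n" if n: "snd n \<notin> ends (fst a)" for n
  proof -
    have "n \<notin> UNIV \<times> X \<or> rayend a a n"
      using n X_V by (cases n) (auto simp: rayend_def V_def)
    then have "M n = L n" by (rule valid_fixed[OF M])
    then show ?thesis using adm_fixed[OF L n, of "fst n"] by simp
  qed
  then show ?thesis using M by (simp add: adm_def valid_def)
qed

lemma valid_outside: "valid M \<Longrightarrow> k \<notin> X \<Longrightarrow> M (h, k) = L (h, k)"
  by (simp add: valid_def)

definition flip :: "int set \<Rightarrow> lbl \<Rightarrow> lbl" where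
  "flip Y M = (\<lambda>n. if snd n \<in> Y then swap (M n) else M n)"

text \<open>Reversing a union of ray-free components on both levels at once yields another
  candidate; this is how the type of a circle is adjusted.\<close>

lemma valid_flip:
  assumes M: "valid M" and Y: "saturated (gr R') Y" "Y \<subseteq> X" "Y \<inter> snd a = {}"
  shows "valid (flip Y M)"
proof -
  have c: "consistent a b a R' M" using M by (simp add: valid_def)
  have "{flip Y M (h, k), flip Y M (h, l)} = {Dn, Up}" if kl: "(k, l) \<in> gr R'" for h k l
  proof -
    have "{M (h, k), M (h, l)} = {Dn, Up}" using c kl unfolding consistent_iff by blast
    then show ?thesis using saturatedD[OF Y(1) kl] swap_opposite by (simp add: flip_def)
  qed
  moreover have "flip Y M (False, k) = flip Y M (True, k) \<and> flip Y M (False, k) \<in> {Dn, Up}"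
    if k: "k \<in> vset b R'" for k
  proof -
    have "M (False, k) = M (True, k) \<and> M (False, k) \<in> {Dn, Up}"
      using c k unfolding consistent_iff by blast
    then show ?thesis by (auto simp: flip_def)
  qed
  ultimately have "consistent a b a R' (flip Y M)" unfolding consistent_iff by blast
  moreover have "flip Y M n = L n" if n: "n \<notin> UNIV \<times> X \<or> rayend a a n" for n
  proof -
    have "snd n \<notin> Y" using n Y by (cases n) (auto simp: rayend_def split: if_splits)
    then show ?thesis using valid_fixed[OF M n] by (simp add: flip_def)
  qed
  ultimately show ?thesis by (simp add: valid_def)
qed

definition rest :: bool where
  "rest \<longleftrightarrow> (\<forall>k\<in>V - X. cond R L k)"

lemma good_before: "good R L \<longleftrightarrow> rest \<and> cond R L i"
proof -
  have "cond R L k = cond R L i" if "k \<in> X" for k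
    using cond_cong[of R k i L] in_X[OF that] by (simp add: X_def)
  then show ?thesis unfolding good_def rest_def using X_V ij_X by blast
qed

lemma good_after:
  assumes M: "valid M"
  shows "good R' M \<longleftrightarrow> rest \<and> cond R' M i \<and> cond R' M j"
proof -
  have "cond R' M k = cond R' M i" if "k \<in> X1" for k
    using cond_cong[of R' k i M] in_X1[OF that] by (simp add: X1_def)
  moreover have "cond R' M k = cond R' M j" if "k \<in> X2" for k
    using cond_cong[of R' k j M] in_X2[OF that] by (simp add: X2_def)
  moreover have "cond R' M k = cond R L k" if k: "k \<in> V - X" for k
  proof -
    have kX: "k \<notin> X" using k by simp
    let ?Y = "component (gr R) k"
    \<comment> \<open>The deciding leftmost vertex of an untouched component lies outside
      \<open>X\<close>, so its labels survive the surgery.\<close>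
    have "Min ?Y \<in> ?Y" by (rule Min_in) (simp_all add: finite_gr_comp[OF R] gr_comp_nonempty)
    then have "component (gr R) (Min ?Y) = ?Y" by (rule component_eq)
    then have "Min ?Y \<notin> X"
      using kX in_X[of "Min ?Y"] component_self[of k "gr R"] by metis
    then show ?thesis
      unfolding cond_def notin_X[OF kX] notin_X_cut[OF kX] Let_def
      by (simp add: valid_outside[OF M])
  qed
  ultimately show ?thesis unfolding good_def rest_def using X_V X_split ij_X by blast
qed

lemma cond_i': "cond R' M i \<longleftrightarrow> X1 \<inter> snd a \<noteq> {} \<or> M (False, Min X1) \<noteq> Dn"
  and cond_j': "cond R' M j \<longleftrightarrow> X2 \<inter> snd a \<noteq> {} \<or> M (False, Min X2) \<noteq> Dn"
  using cut_R' by (simp_all add: cond_def X1_def X2_def Let_def)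

lemma P'_eq: "scomp a b a R' (False, i) = UNIV \<times> X1" and Q'_eq: "scomp a b a R' (False, j) = UNIV \<times> X2"
  using scomp_cut cut_R' by (simp_all add: X1_def X2_def)

lemma label_cases: "k \<in> X \<Longrightarrow> L (h, k) = Dn \<or> L (h, k) = Up"
  using adm_label[OF L, of k h] X_V by auto

lemma valid_label: "valid M \<Longrightarrow> k \<in> X \<Longrightarrow> M (h, k) = Dn \<or> M (h, k) = Up"
  using adm_label[OF valid_adm, of M k h] X_V by auto

lemma Min_X: "Min X \<in> X" "Min X1 \<in> X1" "Min X2 \<in> X2"
  using X_fin X_ne by (auto intro: Min_in)

lemma ij_opposite: "{L (False, i), L (False, j)} = {Dn, Up}"
  using adm_arc[OF L, of i j False] gr_R by auto

lemma valid_reorient: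
  obtains "reorient a b a R' L (UNIV \<times> X) spec = (\<lambda>_. 0)"
  | M where "reorient a b a R' L (UNIV \<times> X) spec = single M" "valid M" "spec M"
  by (rule reorient_cases[of a b a R' L "UNIV \<times> X" spec]) (auto simp: valid_def)

lemma valid_reorient_exists:
  assumes "valid M'" "spec M'"
  obtains M where "reorient a b a R' L (UNIV \<times> X) spec = single M" "valid M" "spec M"
  by (rule reorient_exists[of a b a R' M' "UNIV \<times> X" L spec]) (use assms in \<open>auto simp: valid_def\<close>)

section \<open>Surgery merging a mirror pair of circles\<close>

context
  assumes uncut: "\<not> cut R i"
begin

lemma X_no_ray: "X \<inter> snd a = {}"
  unfolding X_def by (rule uncut_no_ray[OF L R ij_V(1) uncut])

text \<open>If removing the edge disconnected the circle, the piece containing \<open>i\<close> would be balanced by its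
  \<open>a\<close>-edges, but only up to the label of \<open>i\<close> by its remaining \<open>R\<close>-edges.\<close>
lemma X1_X2: "X1 = X" "X2 = X"
proof -
  have XR: "X \<subseteq> ends R" unfolding X_def by (rule uncut_subset_ends[OF R ij_V(1) uncut])
  have "j \<in> X1"
  proof (rule ccontr)
    assume j: "j \<notin> X1"
    have "(\<Sum>k\<in>X1 \<inter> ends (fst a). sg (L (False, k))) = 0"
      by (rule sum_sg_saturated)
        (use fin_a match_a adm_arc[OF L] saturated_mono[OF X_sat(2)] in \<open>auto simp: gr_def\<close>)
    moreover have "X1 \<inter> ends (fst a) = X1" using X_no_ray X_V X_split by (auto simp: V_def)
    moreover have "(\<Sum>k\<in>X1 \<inter> ends R'. sg (L (False, k))) = 0"
      by (rule sum_sg_saturated)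
        (use finite_subset[OF R' fin_b] matching_subset[OF match_b R'] adm_arc[OF L] R'_R
          saturated_mono[OF X_sat(2)] in \<open>auto simp: gr_def\<close>)
    moreover have "X1 \<inter> ends R' = X1 - {i}" using XR X_split j not_ends_R' by (auto simp: ends_R)
    moreover have "(\<Sum>k\<in>X1. sg (L (False, k))) = sg (L (False, i)) + (\<Sum>k\<in>X1 - {i}. sg (L (False, k)))"
      by (rule sum.remove) (use X_fin ij_X in auto)
    ultimately have "sg (L (False, i)) = 0" by simp
    then show False using label_cases[OF ij_X(3), of False] by auto
  qed
  then have "X2 = X1" using in_X1[of j] by (simp add: X2_def)
  then show "X1 = X" "X2 = X" using X_split by auto
qed

text \<open>An opposite pair is good and merges to a clockwise circle, which is good. Two
  anticlockwise circles give an anticlockwise one and two clockwise ones give zero; these are bad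
  before and contribute nothing after.\<close>

lemma surgery_uncut: "evaluates (surg1 a b a R (i, j) L) R' (of_bool (good R L))"
proof -
  have P: "scomp a b a R (h, i) = {h} \<times> X" for h
    using scomp_uncut[OF uncut] by (simp add: X_def)
  have PQ: "{False} \<times> X \<noteq> {True} \<times> X" using X_ne by auto
  have nl: "\<not> is_line a a ({h} \<times> X)" for h using X_no_ray is_line_one by auto
  have U: "{False} \<times> X \<union> {True} \<times> X = UNIV \<times> X" by (auto simp: UNIV_bool)
  let ?t = "\<lambda>h. L (h, Min X) = Dn"
  have eq: "surg1 a b a R (i, j) L =
    (if \<not> ?t False \<and> \<not> ?t True then (\<lambda>_. 0)
     else reorient a b a R' L (UNIV \<times> X) (\<lambda>L'. type1 L' (UNIV \<times> X) = (?t False \<and> ?t True)))"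
    unfolding surg1_def Let_def fst_conv snd_conv P R'_def[symmetric] P'_eq X1_X2 U
    by (simp add: PQ nl type1_one[OF X_fin(1) X_ne(1)])
  have g: "good R L \<longleftrightarrow> rest \<and> (?t False \<noteq> ?t True)"
    unfolding good_before cond_def using uncut by (simp add: X_def[symmetric] Let_def)
  show ?thesis
  proof (cases "\<not> ?t False \<and> \<not> ?t True")
    case True
    then show ?thesis using eq g evaluates_zero by simp
  next
    case False
    \<comment> \<open>Copying the lower labels to the upper line makes the new vertical segments
      consistent. If the merged circle then has the wrong type, reversing it helps.\<close>
    define K where "K = (\<lambda>n. if snd n \<in> X then L (False, snd n) else L n)"
    have K: "valid K"
    proof -
      have "{K (h, k), K (h, l)} = {Dn, Up}" if kl: "(k, l) \<in> gr R'" for h k l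
        using adm_arc[OF L, of k l h] adm_arc[OF L, of k l False] kl gr_R saturatedD[OF X_sat(4) kl]
        by (auto simp: K_def)
      moreover have "K (False, k) = K (True, k) \<and> K (False, k) \<in> {Dn, Up}" if k: "k \<in> vset b R'" for k
      proof (cases "k \<in> X")
        case True then show ?thesis using label_cases[OF True, of False] by (auto simp: K_def)
      next
        case False
        then have "k \<in> vset b R" using k ij_X by (auto simp: vset_R')
        then show ?thesis using adm_vert_label[OF L, of k] False by (auto simp: K_def)
      qed
      ultimately have "consistent a b a R' K" unfolding consistent_iff by blast
      moreover have "K n = L n" if "n \<notin> UNIV \<times> X \<or> rayend a a n" for n
        using that X_no_ray by (cases n) (auto simp: K_def rayend_def split: if_splits)
      ultimately show ?thesis by (simp add: valid_def)
    qed
    have "\<exists>M'. valid M' \<and> (type1 M' (UNIV \<times> X) = (?t False \<and> ?t True))"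
    proof (cases "type1 K (UNIV \<times> X) = (?t False \<and> ?t True)")
      case True then show ?thesis using K by blast
    next
      case False
      have "valid (flip X K)" by (rule valid_flip[OF K X_sat(4)]) (use X_no_ray in auto)
      moreover have "type1 (flip X K) (UNIV \<times> X) = (?t False \<and> ?t True)"
        using False valid_label[OF K Min_X(1), of False] Min_X(1)
        by (auto simp: type1_both[OF X_fin(1) X_ne(1)] flip_def)
      ultimately show ?thesis by blast
    qed
    then obtain M' where M': "valid M'" "type1 M' (UNIV \<times> X) = (?t False \<and> ?t True)" by blast
    obtain M where M: "reorient a b a R' L (UNIV \<times> X) (\<lambda>L'. type1 L' (UNIV \<times> X) = (?t False \<and> ?t True)) = single M"
        "valid M" "type1 M (UNIV \<times> X) = (?t False \<and> ?t True)"
      by (rule valid_reorient_exists[of M' "\<lambda>L'. type1 L' (UNIV \<times> X) = (?t False \<and> ?t True)", OF M'])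
    have "good R' M \<longleftrightarrow> good R L"
      unfolding good_after[OF M(2)] g cond_i' cond_j' X1_X2
      using M(3) False X_no_ray by (auto simp: type1_both[OF X_fin(1) X_ne(1)])
    then show ?thesis using evaluates_single[OF valid_adm[OF M(2)]] M(1) eq False by simp
  qed
qed

end

section \<open>Surgery splitting a symmetric component\<close>

context
  assumes is_cut: "cut R i"
begin

text \<open>The two levels already agree on a symmetric component, so the old labelling suits the
  new vertical segments and can serve as first candidate.\<close>

lemma L_valid: "valid L"
proof -
  have "L (False, k) = L (True, k) \<and> L (False, k) \<in> {Dn, Up}" if k: "k \<in> vset b R'" for k
  proof (cases "k \<in> X")
    case True
    then show ?thesis
      using label_cases[OF True, of False] cut_levels_agree[OF L is_cut, of k] by (auto simp: X_def)
  next
    case False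
    then have "k \<in> vset b R" using k ij_X by (auto simp: vset_R')
    then show ?thesis by (rule adm_vert_label[OF L])
  qed
  then have "consistent a b a R' L" using adm_arc[OF L] gr_R unfolding consistent_iff by blast
  then show ?thesis by (simp add: valid_def)
qed

lemma exists_unset:
  assumes M: "valid M" and Y: "Y \<in> {X1, X2}" "Y \<inter> snd a = {}"
  shows "\<exists>N. valid N \<and> N (False, Min Y) \<noteq> Dn \<and> (\<forall>n. snd n \<notin> Y \<longrightarrow> N n = M n)"
proof (cases "M (False, Min Y) = Dn")
  case True
  have "valid (flip Y M)" using valid_flip[OF M _ _ Y(2)] Y(1) X_sat X_split by auto
  moreover have "flip Y M (False, Min Y) \<noteq> Dn" using True Y(1) Min_X by (auto simp: flip_def)
  ultimately show ?thesis by (intro exI[of _ "flip Y M"]) (simp add: flip_def)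
qed (use M in blast)

lemma P_cut: "scomp a b a R (h, i) = UNIV \<times> X"
  using scomp_cut[OF is_cut] by (simp add: X_def)

text \<open>The rule makes the circle split off from a line clockwise, hence good, and lines impose
  no condition; so goodness reduces to \<open>rest\<close> on both sides.\<close>

lemma surgery_line:
  assumes ray: "X \<inter> snd a \<noteq> {}"
  shows "evaluates (surg1 a b a R (i, j) L) R' (of_bool (good R L))"
proof -
  define Y where "Y = (if is_line a a (UNIV \<times> X1) then X2 else X1)"
  have eq: "surg1 a b a R (i, j) L = reorient a b a R' L (UNIV \<times> X) (\<lambda>L'. \<not> type1 L' (UNIV \<times> Y))"
    unfolding surg1_def Let_def fst_conv snd_conv P_cut R'_def[symmetric] P'_eq Q'_eq Y_def
    using ray by (simp add: is_line_both if_distrib[of "\<lambda>Z. UNIV \<times> Z"])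
  have g: "good R L \<longleftrightarrow> rest"
    unfolding good_before cond_def using is_cut ray by (simp add: X_def[symmetric] Let_def)
  have adm': "adm R' L" by (rule valid_adm[OF L_valid])
  \<comment> \<open>The ends of the cut cap have opposite labels, so one of them differs from
    \<open>s\<close>. Being off \<open>R'\<close> it is terminal for the directed walk, which
    excludes rays of \<open>a\<close> from its piece.\<close>
  have one: "X1 \<inter> snd a = {} \<or> X2 \<inter> snd a = {}"
  proof -
    have "L (False, i) \<noteq> s \<or> L (False, j) \<noteq> s" using ij_opposite by (auto simp: doubleton_eq_iff)
    then show ?thesis
      using terminal_unique[OF adm' R', of _ i] terminal_unique[OF adm' R', of _ j] not_ends_R'
      unfolding X1_def X2_def by blast
  qed
  have Y: "Y \<in> {X1, X2}" "Y \<inter> snd a = {}"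
    using one by (auto simp: Y_def is_line_both)
  have Y': "Y = X1 \<and> X2 \<inter> snd a \<noteq> {} \<or> Y = X2 \<and> X1 \<inter> snd a \<noteq> {}"
    using one ray X_split by (auto simp: Y_def is_line_both)
  have Yf: "finite Y" "Y \<noteq> {}" using Y(1) X_fin X_ne by auto
  obtain N where N: "valid N" "N (False, Min Y) \<noteq> Dn" using exists_unset[OF L_valid Y] by blast
  obtain M where M: "reorient a b a R' L (UNIV \<times> X) (\<lambda>L'. \<not> type1 L' (UNIV \<times> Y)) = single M"
      "valid M" "\<not> type1 M (UNIV \<times> Y)"
    by (rule valid_reorient_exists[of N "\<lambda>L'. \<not> type1 L' (UNIV \<times> Y)"]) (use N type1_both[OF Yf] in auto)
  have "good R' M \<longleftrightarrow> rest"
    unfolding good_after[OF M(2)] cond_i' cond_j' using Y' M(3) type1_both[OF Yf] by auto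
  then show ?thesis using evaluates_single[OF valid_adm[OF M(2)]] M(1) eq g by simp
qed

text \<open>A clockwise circle splits into two clockwise ones. An anticlockwise one yields two
  summands, each with an anticlockwise piece, so both contribute 0.\<close>

lemma surgery_split:
  assumes no_ray: "X \<inter> snd a = {}"
  shows "evaluates (surg1 a b a R (i, j) L) R' (of_bool (good R L))"
proof -
  let ?ro = "reorient a b a R' L (UNIV \<times> X)"
  have nr: "X1 \<inter> snd a = {}" "X2 \<inter> snd a = {}" using no_ray X_split by auto
  note t1 = type1_both[OF X_fin(1) X_ne(1)] type1_both[OF X_fin(2) X_ne(2)] type1_both[OF X_fin(3) X_ne(3)]
  have eq: "surg1 a b a R (i, j) L =
     (if type1 L (UNIV \<times> X)
      then (\<lambda>M. ?ro (\<lambda>L'. type1 L' (UNIV \<times> X1) \<and> \<not> type1 L' (UNIV \<times> X2)) M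
              + ?ro (\<lambda>L'. \<not> type1 L' (UNIV \<times> X1) \<and> type1 L' (UNIV \<times> X2)) M)
      else ?ro (\<lambda>L'. \<not> type1 L' (UNIV \<times> X1) \<and> \<not> type1 L' (UNIV \<times> X2)))"
    unfolding surg1_def Let_def fst_conv snd_conv P_cut R'_def[symmetric] P'_eq Q'_eq
    using no_ray by (simp add: is_line_both)
  have g: "good R L \<longleftrightarrow> rest \<and> \<not> type1 L (UNIV \<times> X)"
    unfolding good_before cond_def using is_cut no_ray by (simp add: X_def[symmetric] t1 Let_def)
  have g': "good R' M \<longleftrightarrow> rest \<and> \<not> type1 M (UNIV \<times> X1) \<and> \<not> type1 M (UNIV \<times> X2)" if "valid M" for M
    unfolding good_after[OF that] cond_i' cond_j' using nr t1 by auto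
  show ?thesis
  proof (cases "type1 L (UNIV \<times> X)")
    case True
    have bad: "evaluates (?ro spec) R' 0"
      if "\<And>M. spec M \<Longrightarrow> type1 M (UNIV \<times> X1) \<or> type1 M (UNIV \<times> X2)" for spec
    proof (rule valid_reorient[of spec])
      assume "?ro spec = (\<lambda>_. 0)" then show ?thesis using evaluates_zero by simp
    next
      fix M assume M: "?ro spec = single M" "valid M" "spec M"
      then have "\<not> good R' M" using that[OF M(3)] g'[OF M(2)] by blast
      then show ?thesis using evaluates_single[OF valid_adm[OF M(2)]] M(1) by simp
    qed
    have "evaluates (surg1 a b a R (i, j) L) R' (0 + 0)"
      unfolding eq if_P[OF True] by (rule evaluates_add; rule bad; blast)
    then show ?thesis using g True by simp
  next
    case False
    obtain N1 where N1: "valid N1" "N1 (False, Min X1) \<noteq> Dn"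
      using exists_unset[OF L_valid _ nr(1)] by blast
    obtain N where N: "valid N" "N (False, Min X2) \<noteq> Dn" "\<And>n. snd n \<notin> X2 \<Longrightarrow> N n = N1 n"
      using exists_unset[OF N1(1) _ nr(2)] by blast
    \<comment> \<open>Adjusting \<open>X2\<close> could spoil \<open>X1\<close> only if they met,
      but then they would be the same component.\<close>
    have "N (False, Min X1) \<noteq> Dn"
    proof (cases "Min X1 \<in> X2")
      case True
      then have "X1 = X2" using in_X1[OF Min_X(2)] in_X2[OF True] by simp
      then show ?thesis using N by simp
    qed (use N N1 in simp)
    then obtain M where M: "?ro (\<lambda>L'. \<not> type1 L' (UNIV \<times> X1) \<and> \<not> type1 L' (UNIV \<times> X2)) = single M"
        "valid M" "\<not> type1 M (UNIV \<times> X1) \<and> \<not> type1 M (UNIV \<times> X2)"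
      using valid_reorient_exists[of N "\<lambda>L'. \<not> type1 L' (UNIV \<times> X1) \<and> \<not> type1 L' (UNIV \<times> X2)"] N t1 by auto
    then show ?thesis
      using evaluates_single[OF valid_adm[OF M(2)]] g'[OF M(2)] g eq False by simp
  qed
qed

end

lemma surgery_evaluates: "evaluates (surg1 a b a R (i, j) L) (R - {(i, j)}) (of_bool (good R L))"
  using surgery_uncut surgery_line surgery_split unfolding R'_def by blast

end

section \<open>Linear extension and the whole run of surgeries\<close>

context stack
begin

text \<open>By linearity it suffices that surgery on a single orientation has count 1 or 0 according
  to its goodness.\<close>

lemma surg_comb_evaluates:
  assumes f: "evaluates f R t" and R: "R \<subseteq> fst b" and p: "p \<in> R"
  shows "evaluates (surg_comb a b a R p f) (R - {p}) t"
proof -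
  obtain i j where ij: "p = (i, j)" by (cases p)
  let ?F = "{L. f L \<noteq> 0}" and ?R = "R - {p}"
  let ?g = "\<lambda>L. surg1 a b a R p L"
  have finF: "finite ?F" and admF: "\<And>L. L \<in> ?F \<Longrightarrow> adm R L"
    and t: "(\<Sum>L\<in>?F. f L * of_bool (good R L)) = t"
    using f by (auto simp: evaluates_def)
  have ev: "evaluates (?g L) ?R (of_bool (good R L))" if "L \<in> ?F" for L
  proof -
    interpret surgery a b s L0 R i j L
      by unfold_locales (use R p ij admF[OF that] in auto)
    show ?thesis using surgery_evaluates ij by simp
  qed
  \<comment> \<open>One finite set containing all supports, so that the two summations can be
    exchanged despite cancellation.\<close>
  let ?S = "\<Union>L\<in>?F. {M. ?g L M \<noteq> 0}"
  have finS: "finite ?S" using finF ev by (auto simp: evaluates_def)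
  have sub: "{M. surg_comb a b a R p f M \<noteq> 0} \<subseteq> ?S"
  proof
    fix M assume "M \<in> {M. surg_comb a b a R p f M \<noteq> 0}"
    then have "(\<Sum>L\<in>?F. f L * ?g L M) \<noteq> 0" by (simp add: surg_comb_def)
    then obtain L where "L \<in> ?F" "f L * ?g L M \<noteq> 0"
      by (rule sum.not_neutral_contains_not_neutral)
    then show "M \<in> ?S" by auto
  qed
  have "(\<Sum>M\<in>{M. surg_comb a b a R p f M \<noteq> 0}. surg_comb a b a R p f M * of_bool (good ?R M))
      = (\<Sum>M\<in>?S. surg_comb a b a R p f M * of_bool (good ?R M))"
    by (rule sum.mono_neutral_left[OF finS sub]) auto
  also have "\<dots> = (\<Sum>M\<in>?S. \<Sum>L\<in>?F. f L * (?g L M * of_bool (good ?R M)))"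
    unfolding surg_comb_def sum_distrib_right by (simp only: mult.assoc)
  also have "\<dots> = (\<Sum>L\<in>?F. f L * (\<Sum>M\<in>?S. ?g L M * of_bool (good ?R M)))"
    unfolding sum_distrib_left by (rule sum.swap)
  also have "\<dots> = (\<Sum>L\<in>?F. f L * of_bool (good R L))"
  proof (rule sum.cong[OF refl])
    fix L assume LF: "L \<in> ?F"
    have "(\<Sum>M\<in>?S. ?g L M * of_bool (good ?R M)) = (\<Sum>M\<in>{M. ?g L M \<noteq> 0}. ?g L M * of_bool (good ?R M))"
      by (rule sum.mono_neutral_right[OF finS]) (use LF in auto)
    also have "\<dots> = of_bool (good R L)" using ev[OF LF] by (simp only: evaluates_def)
    finally show "f L * (\<Sum>M\<in>?S. ?g L M * of_bool (good ?R M)) = f L * of_bool (good R L)" by simp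
  qed
  finally have "(\<Sum>M\<in>{M. surg_comb a b a R p f M \<noteq> 0}. surg_comb a b a R p f M * of_bool (good ?R M)) = t"
    using t by simp
  moreover have "adm ?R M" if nz: "surg_comb a b a R p f M \<noteq> 0" for M
  proof -
    obtain L where "L \<in> ?F" "?g L M \<noteq> 0" using subsetD[OF sub, of M] nz by blast
    then show ?thesis using ev[of L] unfolding evaluates_def by blast
  qed
  ultimately show ?thesis using finite_subset[OF sub finS] by (simp add: evaluates_def)
qed

lemma run_evaluates:
  "evaluates f R t \<Longrightarrow> R \<subseteq> fst b \<Longrightarrow> distinct ps \<Longrightarrow> set ps = R \<Longrightarrow> evaluates (run a b a ps R f) {} t"
proof (induction ps arbitrary: R f)
  case Nil then show ?case by simp
next
  case (Cons p ps)
  have "evaluates (surg_comb a b a R p f) (R - {p}) t"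
    by (rule surg_comb_evaluates[OF Cons.prems(1,2)]) (use Cons.prems(4) in auto)
  moreover have "R - {p} \<subseteq> fst b" "distinct ps" "set ps = R - {p}" using Cons.prems(2-4) by auto
  ultimately have "evaluates (run a b a ps (R - {p}) (surg_comb a b a R p f)) {} t" by (rule Cons.IH)
  then show ?case by simp
qed

end

section \<open>Blocks of finite defect\<close>

lemma bij_moved: "bij \<pi> \<Longrightarrow> \<pi> i \<noteq> i \<Longrightarrow> \<pi> (\<pi> i) \<noteq> \<pi> i"
  by (metis bij_is_inj injD)

lemma block_rel_sym:
  assumes "block_rel w v"
  shows "block_rel v w"
proof -
  obtain \<pi> where p: "bij \<pi>" "finite {i. \<pi> i \<noteq> i}" "\<And>i. \<pi> i \<noteq> i \<Longrightarrow> w i \<in> {Dn, Up}" "v = w \<circ> \<pi>"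
    using assms unfolding block_rel_def by blast
  have moved: "inv \<pi> i \<noteq> i \<longleftrightarrow> \<pi> i \<noteq> i" for i
    using p(1) by (metis bij_inv_eq_iff)
  have "v i \<in> {Dn, Up}" if "inv \<pi> i \<noteq> i" for i
    using p(3)[of "\<pi> i"] p(4) bij_moved[OF p(1), of i] that moved by simp
  moreover have "w = v \<circ> inv \<pi>"
    using p(1,4) by (simp add: fun_eq_iff bij_is_surj surj_f_inv_f)
  moreover have "finite {i. inv \<pi> i \<noteq> i}" using p(2) by (simp only: moved)
  ultimately show ?thesis unfolding block_rel_def using bij_imp_bij_inv[OF p(1)] by blast
qed

lemma block_rel_trans:
  assumes "block_rel w v" "block_rel v u"
  shows "block_rel w u"
proof -
  obtain \<pi> where p: "bij \<pi>" "finite {i. \<pi> i \<noteq> i}" "\<And>i. \<pi> i \<noteq> i \<Longrightarrow> w i \<in> {Dn, Up}" "v = w \<circ> \<pi>"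
    using assms(1) unfolding block_rel_def by blast
  obtain \<rho> where r: "bij \<rho>" "finite {i. \<rho> i \<noteq> i}" "\<And>i. \<rho> i \<noteq> i \<Longrightarrow> v i \<in> {Dn, Up}" "u = v \<circ> \<rho>"
    using assms(2) unfolding block_rel_def by blast
  have sub: "{i. (\<pi> \<circ> \<rho>) i \<noteq> i} \<subseteq> {i. \<pi> i \<noteq> i} \<union> {i. \<rho> i \<noteq> i}" by auto
  have "w i \<in> {Dn, Up}" if i: "(\<pi> \<circ> \<rho>) i \<noteq> i" for i
  proof (cases "\<pi> i = i")
    case True
    then have "\<rho> i \<noteq> i" using i by auto
    then have "v i \<in> {Dn, Up}" by (rule r(3))
    then show ?thesis using True p(4) by simp
  qed (rule p(3))
  moreover have "finite {i. (\<pi> \<circ> \<rho>) i \<noteq> i}" using finite_subset[OF sub] p(2) r(2) by blast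
  moreover have "bij (\<pi> \<circ> \<rho>)" using bij_comp[OF r(1) p(1)] .
  moreover have "u = w \<circ> (\<pi> \<circ> \<rho>)" using p(4) r(4) by (simp add: comp_assoc)
  ultimately show ?thesis unfolding block_rel_def by blast
qed

lemma block_rel_free:
  assumes "block_rel w v" "w k \<notin> {Dn, Up}"
  shows "v k = w k"
proof -
  obtain \<pi> where p: "bij \<pi>" "finite {i. \<pi> i \<noteq> i}" "\<And>i. \<pi> i \<noteq> i \<Longrightarrow> w i \<in> {Dn, Up}" "v = w \<circ> \<pi>"
    using assms(1) unfolding block_rel_def by blast
  then have "\<pi> k = k" using assms(2) by blast
  then show ?thesis using p(4) by simp
qed

lemma is_weight_finite_change:
  assumes "is_weight w" "finite {k. v k \<noteq> w k}"
  shows "is_weight v"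
proof -
  obtain F where F: "finite F" "\<forall>i j. i \<notin> F \<longrightarrow> j \<notin> F \<longrightarrow> i < j \<longrightarrow> \<not> (w i = Dn \<and> w j = Up)"
    using assms(1) unfolding is_weight_def by blast
  have "\<forall>i j. i \<notin> F \<union> {k. v k \<noteq> w k} \<longrightarrow> j \<notin> F \<union> {k. v k \<noteq> w k} \<longrightarrow> i < j \<longrightarrow> \<not> (v i = Dn \<and> v j = Up)"
    using F(2) by fastforce
  moreover have "finite (F \<union> {k. v k \<noteq> w k})" using F(1) assms(2) by simp
  ultimately show ?thesis unfolding is_weight_def by blast
qed

lemma block_mem:
  assumes "is_block \<Lambda>"
  shows "w \<in> \<Lambda> \<Longrightarrow> is_weight w"
    and "w \<in> \<Lambda> \<Longrightarrow> v \<in> \<Lambda> \<Longrightarrow> block_rel w v"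
    and "w \<in> \<Lambda> \<Longrightarrow> is_weight v \<Longrightarrow> block_rel w v \<Longrightarrow> v \<in> \<Lambda>"
proof -
  obtain w0 where L: "\<Lambda> = {v. is_weight v \<and> block_rel w0 v}"
    using assms unfolding is_block_def by blast
  show "w \<in> \<Lambda> \<Longrightarrow> is_weight w" using L by simp
  show "w \<in> \<Lambda> \<Longrightarrow> v \<in> \<Lambda> \<Longrightarrow> block_rel w v"
    using L block_rel_trans[OF block_rel_sym, of w0 w v] by simp
  show "w \<in> \<Lambda> \<Longrightarrow> is_weight v \<Longrightarrow> block_rel w v \<Longrightarrow> v \<in> \<Lambda>"
    using L block_rel_trans[of w0 w v] by simp
qed

text \<open>A window containing all moved vertices is permuted within itself. The signed count over
  large windows is thus a block invariant, and it is used to compare rays of different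
  weights.\<close>

lemma block_rel_sum:
  assumes "block_rel w v"
  obtains T0 where "finite T0"
    "\<And>T. finite T \<Longrightarrow> T0 \<subseteq> T \<Longrightarrow> (\<Sum>k\<in>T. sg (v k)) = (\<Sum>k\<in>T. sg (w k))"
proof -
  obtain \<pi> where p: "bij \<pi>" "finite {i. \<pi> i \<noteq> i}" "\<And>i. \<pi> i \<noteq> i \<Longrightarrow> w i \<in> {Dn, Up}" "v = w \<circ> \<pi>"
    using assms unfolding block_rel_def by blast
  have "(\<Sum>k\<in>T. sg (v k)) = (\<Sum>k\<in>T. sg (w k))" if T: "finite T" "{i. \<pi> i \<noteq> i} \<subseteq> T" for T
  proof -
    have "\<pi> ` T \<subseteq> T"
    proof
      fix x assume "x \<in> \<pi> ` T"
      then obtain i where i: "i \<in> T" "x = \<pi> i" by blast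
      show "x \<in> T"
        using i T(2) bij_moved[OF p(1), of i] by (cases "\<pi> i = i") auto
    qed
    moreover have inj: "inj_on \<pi> T" using p(1) by (meson bij_is_inj inj_on_subset subset_UNIV)
    ultimately have "\<pi> ` T = T" using T(1) by (simp add: endo_inj_surj)
    then have "bij_betw \<pi> T T" using inj by (simp add: bij_betw_def)
    from sum.reindex_bij_betw[OF this, of "\<lambda>k. sg (w k)"] show ?thesis using p(4) by simp
  qed
  then show ?thesis by (rule that[OF p(2)])
qed

text \<open>Swapping the two labels of an arc has the same effect as exchanging its ends, so
  reversing whole arcs is a finite permutation of vees and wedges.\<close>

lemma block_rel_flip:
  assumes m: "finite m" "matching m" and lab: "\<And>i j. (i, j) \<in> m \<Longrightarrow> {w i, w j} = {Dn, Up}"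
    and S: "saturated m S" "S \<subseteq> ends m"
  shows "block_rel w (\<lambda>k. if k \<in> S then swap (w k) else w k)"
    and "is_weight w \<Longrightarrow> is_weight (\<lambda>k. if k \<in> S then swap (w k) else w k)"
proof -
  define q where "q k = (SOME l. (k, l) \<in> m \<or> (l, k) \<in> m)" for k
  have q: "(k, q k) \<in> m \<or> (q k, k) \<in> m" if "k \<in> ends m" for k
  proof -
    have "\<exists>l. (k, l) \<in> m \<or> (l, k) \<in> m" using that by (auto elim: endsE)
    then show ?thesis unfolding q_def by (rule someI_ex)
  qed
  define \<pi> where "\<pi> k = (if k \<in> S then q k else k)" for k
  have qS: "q k \<in> S" if "k \<in> S" for k
    using q[of k] that S saturatedD[OF S(1), of k "q k"] saturatedD[OF S(1), of "q k" k] by blast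
  have qq: "q (q k) = k" if "k \<in> S" for k
  proof -
    have "k \<in> ends m" "q k \<in> ends m" using that qS[OF that] S(2) by blast+
    then have "(q k, k) \<in> m \<or> (k, q k) \<in> m" "(q k, q (q k)) \<in> m \<or> (q (q k), q k) \<in> m"
      using q[of k] q[of "q k"] by argo+
    from matching_partner[OF m(2) this] show ?thesis by simp
  qed
  have inv: "\<pi> (\<pi> k) = k" for k using qS qq by (simp add: \<pi>_def)
  have finS: "finite S" using S(2) finite_ends[OF m(1)] finite_subset by blast
  have opp: "{w k, w (q k)} = {Dn, Up}" if "k \<in> S" for k
    using q[of k] that S(2) lab[of k "q k"] lab[of "q k" k] by (auto simp: insert_commute)
  have "bij \<pi>" by (rule involuntory_imp_bij) (rule inv)
  moreover have "finite {i. \<pi> i \<noteq> i}" by (rule finite_subset[OF _ finS]) (auto simp: \<pi>_def)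
  moreover have "\<forall>i. \<pi> i \<noteq> i \<longrightarrow> w i \<in> {Dn, Up}"
    using opp by (auto simp: \<pi>_def doubleton_eq_iff)
  moreover have "(\<lambda>k. if k \<in> S then swap (w k) else w k) = w \<circ> \<pi>"
  proof
    fix k
    show "(if k \<in> S then swap (w k) else w k) = (w \<circ> \<pi>) k"
      using opp[of k] by (auto simp: \<pi>_def doubleton_eq_iff)
  qed
  ultimately show "block_rel w (\<lambda>k. if k \<in> S then swap (w k) else w k)"
    unfolding block_rel_def by blast
  assume "is_weight w"
  then show "is_weight (\<lambda>k. if k \<in> S then swap (w k) else w k)"
    by (rule is_weight_finite_change) (rule finite_subset[OF _ finS], auto)
qed

lemma oriented_sum_rays:
  assumes c: "cup_diagram c" and o: "oriented c w" and T: "finite T" "ends (fst c) \<subseteq> T"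
  shows "(\<Sum>k\<in>T. sg (w k)) = (\<Sum>k\<in>T \<inter> snd c. sg (w k))"
proof -
  have e: "T \<inter> ends (fst c) = ends (fst c)" using T(2) by blast
  have "(\<Sum>k\<in>T. sg (w k)) = (\<Sum>k\<in>T \<inter> ends (fst c). sg (w k)) + (\<Sum>k\<in>T - ends (fst c). sg (w k))"
    by (rule sum.Int_Diff[OF T(1)])
  also have "(\<Sum>k\<in>T \<inter> ends (fst c). sg (w k)) = 0"
    unfolding e by (rule sum_sg_ends[OF cup_diagramD(1)[OF c] cup_diagram_matching[OF c]])
      (rule orientedD(1)[OF o])
  also have "(\<Sum>k\<in>T - ends (fst c). sg (w k)) = (\<Sum>k\<in>T \<inter> snd c. sg (w k))"
  proof (rule sum.mono_neutral_right)
    show "\<forall>k\<in>T - ends (fst c) - T \<inter> snd c. sg (w k) = 0"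
    proof
      fix k assume "k \<in> T - ends (fst c) - T \<inter> snd c"
      then have "w k \<notin> {Dn, Up}" using oriented_nonfree[OF o] by blast
      then show "sg (w k) = 0" by (cases "w k") auto
    qed
  qed (use T(1) cup_diagramD(7)[OF c] in auto)
  finally show ?thesis by simp
qed

section \<open>Maximal defect and the common label of all rays\<close>

locale finite_block =
  fixes \<Lambda> :: "weight set"
  assumes block: "is_block \<Lambda>" and bounded: "bdd_above (defect ` \<Lambda>)"
begin

lemma core_lower:
  assumes "\<alpha> \<in> core \<Lambda>"
  shows "\<alpha> \<in> \<Lambda>" "is_weight \<alpha>" "cup_diagram (lower \<alpha>)" "oriented (lower \<alpha>) \<alpha>"
    "cdeg (lower \<alpha>) \<alpha> = 0" "card (fst (lower \<alpha>)) = defB \<Lambda>"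
proof -
  show a: "\<alpha> \<in> \<Lambda>" using assms by (simp add: core_def)
  show "is_weight \<alpha>" by (rule block_mem(1)[OF block a])
  then show "cup_diagram (lower \<alpha>)" "oriented (lower \<alpha>) \<alpha>" "cdeg (lower \<alpha>) \<alpha> = 0"
    by (rule lower_props)+
  show "card (fst (lower \<alpha>)) = defB \<Lambda>" using assms by (simp add: core_def defect_def)
qed

text \<open>Otherwise joining two adjacent rays labelled wedge, vee by a cup would give a weight of
  larger defect in the block.\<close>
lemma core_no_up_down_rays:
  assumes \<alpha>: "\<alpha> \<in> core \<Lambda>" and r: "r \<in> snd (lower \<alpha>)" "r' \<in> snd (lower \<alpha>)" "\<alpha> r = Up" "\<alpha> r' = Dn"
  shows False
proof -
  let ?c = "lower \<alpha>"
  note C = core_lower[OF \<alpha>]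
  note D = cup_diagramD[OF C(3)]
  note O = orientedD[OF C(4)]
  let ?P = "\<lambda>(x, y). x \<in> snd ?c \<and> y \<in> snd ?c \<and> \<alpha> x = Up \<and> \<alpha> y = Dn"
  have lt: "x < y" if "?P (x, y)" for x y
    using O(3)[of y x] that by (cases x y rule: linorder_cases) auto
  \<comment> \<open>A closest wedge-vee pair of rays has no ray in between, so the new cup joining
    it encloses none.\<close>
  obtain q where q: "?P q" "\<forall>q'. ?P q' \<longrightarrow> nat (snd q - fst q) \<le> nat (snd q' - fst q')"
    using ex_has_least_nat[of ?P "(r, r')" "\<lambda>q. nat (snd q - fst q)"] r by auto
  obtain x y where xy: "q = (x, y)" by (cases q)
  have P: "x \<in> snd ?c" "y \<in> snd ?c" "\<alpha> x = Up" "\<alpha> y = Dn" using q(1) xy by auto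
  have less: "x < y" using lt[of x y] P by simp
  have gap: False if k: "k \<in> snd ?c" "x < k" "k < y" for k
  proof (cases "\<alpha> k = Up")
    case True
    then have "nat (y - x) \<le> nat (y - k)" using q(2)[rule_format, of "(k, y)"] k P xy by simp
    then show False using k by linarith
  next
    case False
    then have "\<alpha> k = Dn" using O(2)[OF k(1)] by auto
    then have "nat (y - x) \<le> nat (k - x)" using q(2)[rule_format, of "(x, k)"] k P xy by simp
    then show False using k by linarith
  qed
  define \<beta> where "\<beta> = \<alpha>(x := Dn, y := Up)"
  define d where "d = (insert (x, y) (fst ?c), snd ?c - {x, y})"
  have xy_ends: "x \<notin> ends (fst ?c)" "y \<notin> ends (fst ?c)" using D(7) P(1,2) by auto
  have xy_ne: "i \<noteq> x \<and> i \<noteq> y \<and> j \<noteq> x \<and> j \<noteq> y" if "(i, j) \<in> fst ?c" for i j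
    using endsI[OF that] xy_ends by auto
  have disj: "i \<noteq> k \<and> i \<noteq> l \<and> j \<noteq> k \<and> j \<noteq> l"
    if "(i, j) \<in> fst ?c" "(k, l) \<in> fst ?c" "(i, j) \<noteq> (k, l)" for i j k l
    using C(3) that unfolding cup_diagram_def by fast
  have d: "cup_diagram d"
    unfolding cup_diagram_def
  proof (intro conjI ballI)
    show "finite (fst d)" using D(1) by (simp add: d_def)
  next
    fix p assume "p \<in> fst d"
    then show "case p of (i, j) \<Rightarrow> i < j" using D(2) less by (auto simp: d_def)
  next
    fix p assume p: "p \<in> fst d"
    show "case p of (i, j) \<Rightarrow> \<forall>(k, l)\<in>fst d. (i, j) \<noteq> (k, l) \<longrightarrow> i \<noteq> k \<and> i \<noteq> l \<and> j \<noteq> k \<and> j \<noteq> l"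
    proof (clarify, goal_cases)
      case (1 i j k l)
      then consider "(i, j) = (x, y)" "(k, l) = (x, y)" | "(i, j) = (x, y)" "(k, l) \<in> fst ?c"
        | "(i, j) \<in> fst ?c" "(k, l) = (x, y)"
        | "(i, j) \<in> fst ?c" "(k, l) \<in> fst ?c" using p by (auto simp: d_def)
      then show ?case using xy_ne[of i j] xy_ne[of k l] disj[of i j k l] 1 by cases blast+
    qed
  next
    fix p assume p: "p \<in> fst d"
    show "case p of (i, j) \<Rightarrow> \<forall>(k, l)\<in>fst d. \<not> (i < k \<and> k < j \<and> j < l)"
    proof (clarify, goal_cases)
      case (1 i j k l)
      then consider "(i, j) = (x, y)" "(k, l) = (x, y)" | "(i, j) = (x, y)" "(k, l) \<in> fst ?c"
        | "(i, j) \<in> fst ?c" "(k, l) = (x, y)"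
        | "(i, j) \<in> fst ?c" "(k, l) \<in> fst ?c" using p by (auto simp: d_def)
      \<comment> \<open>A cup crossing the new one would have one of the two former rays beneath
        it.\<close>
      then show ?case
        using D(8)[of k l y] D(8)[of i j x] D(6)[of i j k l] 1 P(1,2) by cases auto
    qed
  next
    show "snd d \<inter> ends (fst d) = {}" using D(7) by (auto simp: d_def ends_def)
  next
    fix p assume p: "p \<in> fst d"
    show "case p of (i, j) \<Rightarrow> \<forall>r\<in>snd d. \<not> (i < r \<and> r < j)"
    proof (clarify, goal_cases)
      case (1 i j r)
      then show ?case using p gap[of r] D(8)[of i j r] by (auto simp: d_def)
    qed
  qed
  have o: "oriented d \<beta>"
    unfolding oriented_def
  proof (intro conjI ballI allI impI)
    fix k assume k: "k \<notin> ends (fst d)" "k \<notin> snd d"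
    then have "k \<noteq> x" "k \<noteq> y" "k \<notin> ends (fst ?c)" "k \<notin> snd ?c" by (auto simp: d_def ends_def)
    then show "\<beta> k \<in> {Circ, Cross}" using C(4) by (simp add: oriented_def \<beta>_def)
  next
    fix p assume p: "p \<in> fst d"
    obtain i j where ij: "p = (i, j)" by (cases p)
    show "case p of (i, j) \<Rightarrow> {\<beta> i, \<beta> j} = {Dn, Up}"
    proof (cases "p = (x, y)")
      case False
      then have "(i, j) \<in> fst ?c" using p ij by (auto simp: d_def)
      then show ?thesis using O(1)[of i j] xy_ne[of i j] ij by (simp add: \<beta>_def)
    qed (use less in \<open>simp add: \<beta>_def\<close>)
  next
    fix k assume "k \<in> snd d"
    then show "\<beta> k \<in> {Dn, Up}" using O(2)[of k] by (auto simp: d_def \<beta>_def)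
  next
    fix k l assume "k \<in> snd d" "l \<in> snd d" "k < l"
    then show "\<not> (\<beta> k = Dn \<and> \<beta> l = Up)" using O(3)[of k l] by (auto simp: d_def \<beta>_def)
  qed
  have z: "cdeg d \<beta> = 0"
  proof -
    have "{p \<in> fst d. \<beta> (fst p) = Up} = {}"
      using cdeg_zeroD[OF C(3,4,5)] xy_ne less by (fastforce simp: d_def \<beta>_def)
    then show ?thesis unfolding cdeg_def by (simp only: card.empty)
  qed
  have "(x, y) \<notin> fst ?c" using xy_ne by blast
  then have "defect \<beta> = Suc (defect \<alpha>)"
    using lower_eqI[OF d o z] D(1) by (simp add: defect_def d_def)
  moreover have "\<beta> \<in> \<Lambda>"
  proof (rule block_mem(3)[OF block C(1)])
    have "{k. \<beta> k \<noteq> \<alpha> k} \<subseteq> {x, y}" by (auto simp: \<beta>_def)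
    then show "is_weight \<beta>"
      by (intro is_weight_finite_change[OF C(2)] finite_subset[OF _ finite.insertI[OF finite.insertI[OF finite.emptyI]]])
    define \<pi> :: "int \<Rightarrow> int" where "\<pi> = id(x := y, y := x)"
    have "bij \<pi>" by (rule involuntory_imp_bij) (simp add: \<pi>_def)
    moreover have "finite {i. \<pi> i \<noteq> i}"
      by (rule finite_subset[of _ "{x, y}"]) (auto simp: \<pi>_def split: if_splits)
    moreover have "\<forall>i. \<pi> i \<noteq> i \<longrightarrow> \<alpha> i \<in> {Dn, Up}" using P by (simp add: \<pi>_def)
    moreover have "\<beta> = \<alpha> \<circ> \<pi>" using P less by (auto simp: \<pi>_def \<beta>_def)
    ultimately show "block_rel \<alpha> \<beta>" unfolding block_rel_def by blast
  qed
  moreover have "defect \<beta> \<le> defect \<alpha>" if "\<beta> \<in> \<Lambda>"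
    using cSup_upper[OF imageI[OF that] bounded] \<alpha> by (simp add: core_def defB_def)
  ultimately show False by simp
qed

text \<open>Within one core diagram the rays of its own weight are uniformly labelled, so the
  invariant signed count of the block fixes their sign. For another orientation \<open>w\<close> of
  the same diagram that count is extremal, which forces every ray to have the same label.\<close>

lemma core_rays_eq:
  assumes \<alpha>: "\<alpha> \<in> core \<Lambda>" "r \<in> snd (lower \<alpha>)" and \<beta>: "\<beta> \<in> core \<Lambda>" and w: "w \<in> \<Lambda>" "oriented (lower \<beta>) w"
    and r': "r' \<in> snd (lower \<beta>)"
  shows "w r' = \<alpha> r"
proof -
  note A = core_lower[OF \<alpha>(1)]
  note B = core_lower[OF \<beta>]
  have unif: "\<gamma> k = \<gamma> l" if "\<gamma> \<in> core \<Lambda>" "k \<in> snd (lower \<gamma>)" "l \<in> snd (lower \<gamma>)" for \<gamma> k l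
    using core_no_up_down_rays[OF that] core_no_up_down_rays[OF that(1,3,2)]
      orientedD(2)[OF core_lower(4)[OF that(1)], of k] orientedD(2)[OF core_lower(4)[OF that(1)], of l] that
    by auto
  obtain T1 where T1: "finite T1" "\<And>T. finite T \<Longrightarrow> T1 \<subseteq> T \<Longrightarrow> (\<Sum>k\<in>T. sg (\<beta> k)) = (\<Sum>k\<in>T. sg (\<alpha> k))"
    using block_rel_sum[OF block_mem(2)[OF block A(1) B(1)]] by blast
  obtain T2 where T2: "finite T2" "\<And>T. finite T \<Longrightarrow> T2 \<subseteq> T \<Longrightarrow> (\<Sum>k\<in>T. sg (w k)) = (\<Sum>k\<in>T. sg (\<beta> k))"
    using block_rel_sum[OF block_mem(2)[OF block B(1) w(1)]] by blast
  \<comment> \<open>Including \<open>r\<close> and \<open>r'\<close> makes both ray counts in the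
    window positive, so the signs can be compared.\<close>
  define T where "T = {r, r'} \<union> ends (fst (lower \<alpha>)) \<union> ends (fst (lower \<beta>)) \<union> T1 \<union> T2"
  have T: "finite T" "T1 \<subseteq> T" "T2 \<subseteq> T" "ends (fst (lower \<alpha>)) \<subseteq> T" "ends (fst (lower \<beta>)) \<subseteq> T" "r \<in> T" "r' \<in> T"
    using T1(1) T2(1) cup_diagramD(1)[OF A(3)] cup_diagramD(1)[OF B(3)] by (auto simp: T_def finite_ends)
  let ?A = "T \<inter> snd (lower \<alpha>)" and ?B = "T \<inter> snd (lower \<beta>)"
  have sA: "(\<Sum>k\<in>T. sg (\<alpha> k)) = sg (\<alpha> r) * int (card ?A)"
  proof -
    have "(\<Sum>k\<in>T. sg (\<alpha> k)) = (\<Sum>k\<in>?A. sg (\<alpha> k))" by (rule oriented_sum_rays[OF A(3,4) T(1,4)])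
    also have "\<dots> = (\<Sum>k\<in>?A. sg (\<alpha> r))"
    proof (rule sum.cong[OF refl])
      fix k assume "k \<in> ?A"
      then have "\<alpha> k = \<alpha> r" using unif[OF \<alpha>(1) _ \<alpha>(2), of k] by simp
      then show "sg (\<alpha> k) = sg (\<alpha> r)" by simp
    qed
    finally show ?thesis by simp
  qed
  have sB: "(\<Sum>k\<in>T. sg (\<beta> k)) = (\<Sum>k\<in>?B. sg (\<beta> r'))"
  proof -
    have "(\<Sum>k\<in>T. sg (\<beta> k)) = (\<Sum>k\<in>?B. sg (\<beta> k))" by (rule oriented_sum_rays[OF B(3,4) T(1,5)])
    also have "\<dots> = (\<Sum>k\<in>?B. sg (\<beta> r'))"
    proof (rule sum.cong[OF refl])
      fix k assume "k \<in> ?B"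
      then have "\<beta> k = \<beta> r'" using unif[OF \<beta> _ r', of k] by simp
      then show "sg (\<beta> k) = sg (\<beta> r')" by simp
    qed
    finally show ?thesis .
  qed
  have sw: "(\<Sum>k\<in>T. sg (w k)) = (\<Sum>k\<in>?B. sg (w k))" by (rule oriented_sum_rays[OF B(3) w(2) T(1,5)])
  have cA: "card ?A > 0" using T \<alpha>(2) by (auto simp: card_gt_0_iff)
  have cB: "card ?B > 0" using T r' by (auto simp: card_gt_0_iff)
  have lA: "\<alpha> r \<in> {Dn, Up}" and lB: "\<beta> r' \<in> {Dn, Up}"
    using orientedD(2)[OF A(4) \<alpha>(2)] orientedD(2)[OF B(4) r'] by auto
  have "sg (\<beta> r') * int (card ?B) = sg (\<alpha> r) * int (card ?A)"
    using T1(2)[OF T(1,2)] sA sB by (simp add: mult.commute)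
  then have ab: "\<beta> r' = \<alpha> r" using lA lB cA cB by auto
  have "(\<Sum>k\<in>?B. sg (w k)) = (\<Sum>k\<in>?B. sg (\<beta> r'))"
    using T2(2)[OF T(1,3)] sB sw by simp
  \<comment> \<open>The extremality argument: every deviation from the uniform label has the same
    sign, and the deviations sum to 0.\<close>
  then have "(\<Sum>k\<in>?B. sg (\<beta> r') * (sg (\<beta> r') - sg (w k))) = 0"
    by (simp add: sum_distrib_left[symmetric] sum_subtractf)
  moreover have "sg (\<beta> r') * (sg (\<beta> r') - sg l) \<ge> 0" for l
    using lB sg_bounds[of l] by auto
  ultimately have "\<forall>k\<in>?B. sg (\<beta> r') * (sg (\<beta> r') - sg (w k)) = 0"
    using T(1) by (subst (asm) sum_nonneg_eq_0_iff) auto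
  then have "sg (w r') = sg (\<beta> r')" using T r' lB by auto
  then have "w r' = \<beta> r'" using lB by (cases "w r'") auto
  then show ?thesis using ab by simp
qed

lemma core_ray_label:
  obtains s where "s \<in> {Dn, Up}"
    "\<And>\<alpha> w r. \<alpha> \<in> core \<Lambda> \<Longrightarrow> w \<in> \<Lambda> \<Longrightarrow> oriented (lower \<alpha>) w \<Longrightarrow> r \<in> snd (lower \<alpha>) \<Longrightarrow> w r = s"
proof (cases "\<exists>\<alpha> r. \<alpha> \<in> core \<Lambda> \<and> r \<in> snd (lower \<alpha>)")
  case True
  then obtain \<alpha> r where a: "\<alpha> \<in> core \<Lambda>" "r \<in> snd (lower \<alpha>)" by blast
  show ?thesis
    by (rule that[of "\<alpha> r"]) (use orientedD(2)[OF core_lower(4)[OF a(1)] a(2)] core_rays_eq[OF a] in blast)+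
next
  case False
  then show ?thesis using that[of Dn] by blast
qed

end

section \<open>The symmetrising form\<close>

text \<open>The orientation with all cups clockwise. For a core diagram it gives the only top-degree
  basis vector with that diagram on the outside.\<close>

definition top_weight :: "diag \<Rightarrow> weight \<Rightarrow> weight" where
  "top_weight c w k = (if k \<in> fst ` fst c then Up else if k \<in> snd ` fst c then Dn else w k)"

lemma component_conn1: "component (fst a \<union> fst b) k = {m. (k, m) \<in> conn1 a b}"
proof -
  have "fst a \<union> fst b \<union> (fst a \<union> fst b)\<inverse> = fst a \<union> fst b \<union> (fst a)\<inverse> \<union> (fst b)\<inverse>" by auto
  then show ?thesis by (simp add: component_def conn1_def Image_def)
qed

lemma surg_order_props: "finite R \<Longrightarrow> set (surg_order R) = R \<and> distinct (surg_order R)"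
proof -
  assume "finite R"
  then obtain xs where xs: "set xs = R" "distinct xs" using finite_distinct_list by blast
  \<comment> \<open>The key is minus the width, so ascending order means widest first.\<close>
  let ?ys = "sort_key (\<lambda>p. fst p - snd p) xs"
  have "sorted_wrt (\<lambda>p q. fst p - snd p \<le> fst q - snd q) ?ys"
    using sorted_sort_key[of "\<lambda>p. fst p - snd p" xs] by (simp add: sorted_map)
  then have "sorted_wrt (\<lambda>p q. snd q - fst q \<le> snd p - fst p) ?ys"
    by (rule sorted_wrt_mono_rel[rotated]) simp
  then have "\<exists>xs. set xs = R \<and> distinct xs \<and> sorted_wrt (\<lambda>p q. snd q - fst q \<le> snd p - fst p) xs"
    using xs by (intro exI[of _ ?ys]) simp
  from someI_ex[OF this] show ?thesis unfolding surg_order_def by blast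
qed

section \<open>Goodness of the initial and of the final orientation\<close>

context stack
begin

text \<open>Before any surgery the vertical segments sit exactly at the rays of \<open>b\<close>; a
  component avoiding these also avoids the rays of \<open>a\<close>, by the signed count.\<close>

lemma uncut_iff_in_circle: "in_circle a b k \<longleftrightarrow> k \<in> V \<and> \<not> cut (fst b) k"
proof -
  have comp: "component (gr (fst b)) k = {m. (k, m) \<in> conn1 a b}"
    unfolding gr_def by (rule component_conn1)
  have vs: "vset b (fst b) = snd b" by (auto simp: vset_def)
  have adm: "adm (fst b) L0" using L0_consistent by (simp add: adm_def)
  show ?thesis
  proof
    assume "in_circle a b k"
    then have "k \<in> ends (fst a)" "component (gr (fst b)) k \<subseteq> ends (fst b)"
      unfolding in_circle_def comp by auto
    then show "k \<in> V \<and> \<not> cut (fst b) k" using disj_b by (auto simp: V_def cut_def vs)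
  next
    assume k: "k \<in> V \<and> \<not> cut (fst b) k"
    have "component (gr (fst b)) k \<subseteq> ends (fst b)"
      using uncut_subset_ends[of "fst b" k] k by simp
    moreover have "component (gr (fst b)) k \<inter> snd a = {}" using uncut_no_ray[OF adm] k by simp
    moreover have "component (gr (fst b)) k \<subseteq> V" using component_V k by simp
    ultimately have "component (gr (fst b)) k \<subseteq> ends (fst a) \<inter> ends (fst b)" by (auto simp: V_def)
    then show "in_circle a b k"
      using component_self[of k "gr (fst b)"] unfolding in_circle_def comp by blast
  qed
qed

text \<open>Initially a symmetric component contains a ray of \<open>b\<close>. Without a ray of
  \<open>a\<close>, balance would make the signed count of equally labelled rays vanish; so the
  component is a line.\<close>

lemma cond_cut:
  assumes k: "k \<in> V" "cut (fst b) k"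
  shows "cond (fst b) L0 k"
proof -
  let ?X = "component (gr (fst b)) k"
  have adm: "adm (fst b) L0" using L0_consistent by (simp add: adm_def)
  have X: "saturated (gr (fst b)) ?X" "finite ?X" "?X \<subseteq> V"
    by (rule component_saturated finite_gr_comp[OF subset_refl] component_V[OF subset_refl k(1)])+
  have "?X \<inter> snd a \<noteq> {}"
  proof
    assume e: "?X \<inter> snd a = {}"
    have d: "?X - ends (fst b) = ?X \<inter> snd b"
      using X(3) same_support disj_b by (auto simp: V_def)
    have "(\<Sum>k\<in>?X \<inter> snd b. sg (L0 (False, k))) = 0"
      using balance[OF adm subset_refl X, of False] unfolding e d by simp
    then have "?X \<inter> snd b = {}"
      by (rule sum_sg_const[rotated 3]) (use X(2) s_label L0_rays_b in auto)
    then show False using k(2) by (auto simp: cut_def vset_def)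
  qed
  then show ?thesis using k by (simp add: cond_def Let_def)
qed

text \<open>Labels alternate along the arcs on both levels, so opposite labels at the leftmost
  vertex mean opposite labels everywhere.\<close>

lemma cond_uncut:
  assumes k: "k \<in> V" "\<not> cut (fst b) k"
  shows "cond (fst b) L0 k \<longleftrightarrow>
    (\<forall>m\<in>component (gr (fst b)) k. L0 (True, m) = swap (L0 (False, m)))"
proof -
  let ?X = "component (gr (fst b)) k"
  have adm: "adm (fst b) L0" using L0_consistent by (simp add: adm_def)
  have "Min ?X \<in> ?X" by (rule Min_in) (simp_all add: finite_gr_comp gr_comp_nonempty)
  then have minX: "component (gr (fst b)) (Min ?X) = ?X" "Min ?X \<in> V" "Min ?X \<in> ?X"
    using component_eq[of "Min ?X"] subsetD[OF component_V[OF subset_refl k(1)]] by simp_all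
  have "saturated (gr (fst b)) {m. L0 (True, m) = swap (L0 (False, m))}"
    unfolding saturated_def
  proof clarify
    fix i j assume "(i, j) \<in> gr (fst b)"
    from adm_arc[OF adm this, of True] adm_arc[OF adm this, of False]
    show "i \<in> {m. L0 (True, m) = swap (L0 (False, m))} \<longleftrightarrow> j \<in> {m. L0 (True, m) = swap (L0 (False, m))}"
      by (auto simp: doubleton_eq_iff)
  qed
  then have "L0 (True, Min ?X) = swap (L0 (False, Min ?X)) \<Longrightarrow> m \<in> ?X \<Longrightarrow> L0 (True, m) = swap (L0 (False, m))" for m
    using component_least[of "gr (fst b)" _ "Min ?X"] minX(1) by blast
  moreover have "L0 (True, Min ?X) = swap (L0 (False, Min ?X)) \<longleftrightarrow> (L0 (False, Min ?X) = Dn) \<noteq> (L0 (True, Min ?X) = Dn)"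
    using adm_label[OF adm minX(2), of False] adm_label[OF adm minX(2), of True] by auto
  ultimately show ?thesis using k minX(3) unfolding cond_def Let_def by auto
qed

lemma good_initial:
  "good (fst b) L0 \<longleftrightarrow>
    (\<forall>k\<in>V. L0 (True, k) = (if in_circle a b k then swap (L0 (False, k)) else L0 (False, k)))"
proof -
  have adm: "adm (fst b) L0" using L0_consistent by (simp add: adm_def)
  have ag: "L0 (True, k) = L0 (False, k)" if "k \<in> V" "\<not> in_circle a b k" for k
    using that cut_levels_agree[OF adm, of k k] by (simp add: uncut_iff_in_circle)
  have circ: "in_circle a b m" if "in_circle a b k" "m \<in> component (gr (fst b)) k" for k m
    using that component_eq[OF that(2)] component_V[of "fst b" k] unfolding uncut_iff_in_circle cut_def by auto
  show ?thesis
  proof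
    assume g: "good (fst b) L0"
    show "\<forall>k\<in>V. L0 (True, k) = (if in_circle a b k then swap (L0 (False, k)) else L0 (False, k))"
      using ag g cond_uncut component_self unfolding good_def by (auto simp: uncut_iff_in_circle)
  next
    assume r: "\<forall>k\<in>V. L0 (True, k) = (if in_circle a b k then swap (L0 (False, k)) else L0 (False, k))"
    have "cond (fst b) L0 k" if k: "k \<in> V" for k
    proof (cases "cut (fst b) k")
      case True then show ?thesis by (rule cond_cut[OF k])
    next
      case False
      have "L0 (True, m) = swap (L0 (False, m))" if "m \<in> component (gr (fst b)) k" for m
        using r circ[of k m] that k False uncut_iff_in_circle by auto
      then show ?thesis using cond_uncut[OF k False] by blast
    qed
    then show "good (fst b) L0" unfolding good_def by blast
  qed
qed

text \<open>Once all caps are cut, every labelled position carries a vertical segment and the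
  components are single cups of \<open>a\<close> and rays. Goodness then asks each cup to be
  clockwise, and the remaining labels are fixed by \<open>adm\<close>.\<close>

lemma good_final:
  assumes L: "adm {} L" and less: "\<And>i j. (i, j) \<in> fst a \<Longrightarrow> i < j"
  shows "good {} L \<longleftrightarrow> (\<lambda>k. L (False, k)) = top_weight a (\<lambda>k. L0 (False, k))"
proof -
  have vs: "vset b {} = V" using same_support by (simp add: vset_def V_def ends_def)
  have cut: "cut {} k" if "k \<in> V" for k using that component_self[of k "gr {}"] unfolding cut_def vs by blast
  have part: "component (gr {}) k = {i, j}" if ij: "(i, j) \<in> fst a" "k \<in> {i, j}" for i j k
  proof
    have "k \<in> {i, j} \<longleftrightarrow> l \<in> {i, j}" if kl: "(k, l) \<in> fst a" for k l
      using matching_partner[OF match_a, of i j l] matching_partner[OF match_a, of j i l]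
        matching_partner[OF match_a, of i j k] matching_partner[OF match_a, of j i k] ij(1) kl by blast
    then have "saturated (gr {}) {i, j}" unfolding saturated_def gr_def by blast
    then show "component (gr {}) k \<subseteq> {i, j}" using ij(2) by (rule component_least)
    have "i \<in> component (gr {}) k \<longleftrightarrow> j \<in> component (gr {}) k"
      by (rule saturatedD[OF component_saturated]) (simp add: gr_def ij)
    then show "{i, j} \<subseteq> component (gr {}) k" using ij(2) component_self[of k "gr {}"] by auto
  qed
  have ray: "cond {} L k" if "k \<in> snd a" for k
  proof -
    have "component (gr {}) k \<inter> snd a \<noteq> {}" using that component_self[of k "gr {}"] by blast
    then show ?thesis using cut[of k] that by (simp add: cond_def Let_def V_def)
  qed
  have cup: "cond {} L k \<longleftrightarrow> L (False, i) = Up" if ij: "(i, j) \<in> fst a" "k \<in> {i, j}" for i j k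
  proof -
    have V: "k \<in> V" "i \<in> V" using endsI[OF ij(1)] ij(2) by (auto simp: V_def)
    have "{i, j} \<inter> snd a = {}" using endsI[OF ij(1)] disj_a by auto
    moreover have "Min {i, j} = i" using less[OF ij(1)] by simp
    ultimately have "cond {} L k \<longleftrightarrow> L (False, i) \<noteq> Dn"
      using cut[OF V(1)] by (simp add: cond_def Let_def part[OF ij])
    then show ?thesis using adm_label[OF L V(2), of False] by auto
  qed
  have "good {} L \<longleftrightarrow> (\<forall>(i, j)\<in>fst a. L (False, i) = Up)"
  proof
    assume g: "good {} L"
    have "L (False, i) = Up" if ij: "(i, j) \<in> fst a" for i j
      using g cup[OF ij, of i] endsI(1)[OF ij] by (auto simp: good_def V_def)
    then show "\<forall>(i, j)\<in>fst a. L (False, i) = Up" by blast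
  next
    assume u: "\<forall>(i, j)\<in>fst a. L (False, i) = Up"
    have "cond {} L k" if "k \<in> V" for k
    proof (cases "k \<in> snd a")
      case False
      then have "k \<in> ends (fst a)" using that by (simp add: V_def)
      then obtain i j where "(i, j) \<in> fst a" "k \<in> {i, j}" by (auto elim!: endsE)
      then show ?thesis using cup u by blast
    qed (rule ray)
    then show "good {} L" by (simp add: good_def)
  qed
  also have "\<dots> \<longleftrightarrow> (\<lambda>k. L (False, k)) = top_weight a (\<lambda>k. L0 (False, k))"
  proof
    assume u: "\<forall>(i, j)\<in>fst a. L (False, i) = Up"
    show "(\<lambda>k. L (False, k)) = top_weight a (\<lambda>k. L0 (False, k))"
    proof
      fix k
      consider (left) j where "(k, j) \<in> fst a" | (right) i where "(i, k) \<in> fst a" | (none) "k \<notin> ends (fst a)"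
        by (blast elim: endsE)
      then show "L (False, k) = top_weight a (\<lambda>k. L0 (False, k)) k"
      proof cases
        case left
        then show ?thesis using u by (force simp: top_weight_def)
      next
        case right
        have "k \<notin> fst ` fst a"
        proof
          assume "k \<in> fst ` fst a"
          then obtain j where j: "(k, j) \<in> fst a" by auto
          then have "i = j" using matching_partner[OF match_a, of k i j] right by blast
          then show False using less[OF right] less[OF j] by simp
        qed
        moreover have "{L (False, i), L (False, k)} = {Dn, Up}" "L (False, i) = Up"
          using adm_arc[OF L, of i k False] right u by (auto simp: gr_def)
        ultimately show ?thesis using right by (force simp: top_weight_def doubleton_eq_iff)
      next
        case none
        then show ?thesis using adm_fixed[OF L none, of False] by (auto simp: top_weight_def ends_def)
      qed
    qed
  next
    assume t: "(\<lambda>k. L (False, k)) = top_weight a (\<lambda>k. L0 (False, k))"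
    have "L (False, i) = Up" if "(i, j) \<in> fst a" for i j
      using fun_cong[OF t, of i] that by (force simp: top_weight_def)
    then show "\<forall>(i, j)\<in>fst a. L (False, i) = Up" by blast
  qed
  finally show ?thesis .
qed

text \<open>A product coefficient is a sum over all labellings with a given lower line. For the top
  weight these are precisely the good ones, so the invariant of the run computes it.\<close>

lemma top_coefficient:
  assumes less: "\<And>i j. (i, j) \<in> fst a \<Longrightarrow> i < j"
    and f: "f = run a b a (surg_order (fst b)) (fst b) (single L0)"
  shows "(\<Sum>L\<in>{L. f L \<noteq> 0 \<and> (\<lambda>k. L (False, k)) = top_weight a (\<lambda>k. L0 (False, k))}. f L)
    = of_bool (good (fst b) L0)"
proof -
  have "adm (fst b) L0" using L0_consistent by (simp add: adm_def)
  then have "evaluates f {} (of_bool (good (fst b) L0))"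
    unfolding f using run_evaluates[OF evaluates_single] surg_order_props[OF fin_b] by blast
  then have fin: "finite {M. f M \<noteq> 0}" and adm: "\<And>M. f M \<noteq> 0 \<Longrightarrow> adm {} M"
    and t: "(\<Sum>M\<in>{M. f M \<noteq> 0}. f M * of_bool (good {} M)) = of_bool (good (fst b) L0)"
    by (auto simp only: evaluates_def)
  have "(\<Sum>L\<in>{L. f L \<noteq> 0 \<and> (\<lambda>k. L (False, k)) = top_weight a (\<lambda>k. L0 (False, k))}. f L)
      = (\<Sum>M\<in>{M. f M \<noteq> 0}. f M * of_bool (good {} M))"
    by (rule sum.mono_neutral_cong_left[OF fin]) (use adm good_final[OF _ less] in auto)
  then show ?thesis using t by simp
qed

end

text \<open>Circles are recognised symmetrically from the two diagrams, since a vertex lies in its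
  own component; the second application therefore swaps the same vertices back.\<close>

lemma sharp_sharp: "sharp (sharp x) = x"
proof -
  obtain a w b where x: "x = (a, w, b)" by (metis prod_cases3)
  have "conn1 b a = conn1 a b" unfolding conn1_def by (rule arg_cong[where f = rtrancl]) auto
  moreover have "(k, k) \<in> conn1 a b" for k by (simp add: conn1_def)
  ultimately have "in_circle b a k = in_circle a b k" for k
    unfolding in_circle_def by blast
  then show ?thesis by (auto simp: x sharp_def)
qed

lemma prod_basis_nonzero: "prod_basis x y z \<noteq> 0 \<Longrightarrow> fst z = fst x \<and> snd (snd z) = snd (snd y) \<and> snd (snd x) = fst y"
  by (auto simp: prod_basis_def Let_def split: prod.splits if_splits)

section \<open>Top-degree basis vectors and evaluation of the trace\<close>

context finite_block
begin

lemma basisHE: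
  assumes "(a, w, b) \<in> basisH \<Lambda>"
  obtains \<alpha> \<beta> where "a = lower \<alpha>" "b = lower \<beta>" "\<alpha> \<in> core \<Lambda>" "\<beta> \<in> core \<Lambda>" "w \<in> \<Lambda>"
    "oriented a w" "oriented b w"
  using assms unfolding basisH_def subw_def by blast

lemma basisHI:
  assumes "\<alpha> \<in> core \<Lambda>" "\<beta> \<in> core \<Lambda>" "w \<in> \<Lambda>" "oriented (lower \<alpha>) w" "oriented (lower \<beta>) w"
  shows "(lower \<alpha>, w, lower \<beta>) \<in> basisH \<Lambda>"
proof -
  have "subw \<alpha> w" "subw \<beta> w"
    unfolding subw_def using assms block_mem(2)[OF block] core_lower(1) by blast+
  then show ?thesis unfolding basisH_def using assms(1-3) by blast
qed

lemma stack_of_basis: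
  assumes x: "(a, w, b) \<in> basisH \<Lambda>" and y: "(b, v, a) \<in> basisH \<Lambda>"
  obtains s where "stack a b s (\<lambda>n. if fst n then v (snd n) else w (snd n))"
proof -
  obtain \<alpha> \<beta> where X: "a = lower \<alpha>" "b = lower \<beta>" "\<alpha> \<in> core \<Lambda>" "\<beta> \<in> core \<Lambda>" "w \<in> \<Lambda>"
    "oriented a w" "oriented b w" using x by (rule basisHE)
  obtain v: "v \<in> \<Lambda>" "oriented a v" "oriented b v" using y by (elim basisHE) blast
  obtain s where s: "s \<in> {Dn, Up}"
    "\<And>\<alpha> w r. \<alpha> \<in> core \<Lambda> \<Longrightarrow> w \<in> \<Lambda> \<Longrightarrow> oriented (lower \<alpha>) w \<Longrightarrow> r \<in> snd (lower \<alpha>) \<Longrightarrow> w r = s"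
    using core_ray_label by blast
  note A = core_lower(3)[OF X(3), folded X(1)] and B = core_lower(3)[OF X(4), folded X(2)]
  let ?L = "\<lambda>n. if fst n then v (snd n) else w (snd n)"
  have "consistent a b a (fst b) ?L"
  proof -
    have "{w i, w j} = {Dn, Up}" "{v i, v j} = {Dn, Up}" if "(i, j) \<in> fst a \<union> fst b" for i j
      using that orientedD(1)[OF X(6)] orientedD(1)[OF X(7)] orientedD(1)[OF v(2)] orientedD(1)[OF v(3)] by blast+
    moreover have "w k = s \<and> v k = s" if "k \<in> snd b" for k
      using that s(2)[OF X(4)] X v by blast
    ultimately have k: "\<And>k. k \<in> snd b \<Longrightarrow> w k = s \<and> v k = s"
      and ij: "\<And>i j. (i, j) \<in> fst a \<union> fst b \<Longrightarrow> {w i, w j} = {Dn, Up} \<and> {v i, v j} = {Dn, Up}" by blast+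
    show ?thesis
      unfolding consistent_def
    proof (intro conjI ballI)
      fix p assume "p \<in> arcs a a (fst b)"
      then obtain h i j where "p = ((h, i), (h, j))" "(i, j) \<in> fst a \<union> fst b" unfolding arcs_def by blast
      then show "case p of (n, m) \<Rightarrow> {?L n, ?L m} = {Dn, Up}" using ij[of i j] by simp
    next
      fix p assume "p \<in> verts b (fst b)"
      then obtain i where "p = ((False, i), (True, i))" "i \<in> snd b" unfolding verts_def by blast
      then show "case p of (n, m) \<Rightarrow> ?L n = ?L m \<and> ?L n \<in> {Dn, Up}" using k[of i] s(1) by simp
    qed
  qed
  then have "stack a b s ?L"
  proof (unfold_locales, goal_cases)
    case 1 show ?case by (rule cup_diagramD(1)[OF A])
  next
    case 2 show ?case by (rule cup_diagramD(1)[OF B])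
  next
    case 3 show ?case by (rule cup_diagram_matching[OF A])
  next
    case 4 show ?case by (rule cup_diagram_matching[OF B])
  next
    case 5 show ?case by (rule cup_diagramD(7)[OF A])
  next
    case 6 show ?case by (rule cup_diagramD(7)[OF B])
  next
    case 7 show ?case using oriented_nonfree[OF X(6)] oriented_nonfree[OF X(7)] by simp
  next
    case (9 k h) then show ?case using s(2)[OF X(3)] X v by auto
  next
    case (10 k h) then show ?case using s(2)[OF X(4)] X v by auto
  next
    case 11 show ?case by (rule s(1))
  qed
  then show ?thesis by (rule that)
qed

text \<open>Circles consist of whole arcs and avoid rays, so reversing them preserves both
  orientations and the block. This supplies the dual vectors for nondegeneracy.\<close>

lemma sharp_basis:
  assumes "x \<in> basisH \<Lambda>"
  shows "sharp x \<in> basisH \<Lambda>"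
proof -
  obtain a w b where x: "x = (a, w, b)" by (metis prod_cases3)
  obtain \<alpha> \<beta> where X: "a = lower \<alpha>" "b = lower \<beta>" "\<alpha> \<in> core \<Lambda>" "\<beta> \<in> core \<Lambda>" "w \<in> \<Lambda>"
    "oriented a w" "oriented b w" using assms unfolding x by (rule basisHE)
  note A = core_lower(3)[OF X(3), folded X(1)] and B = core_lower(3)[OF X(4), folded X(2)]
  let ?S = "{k. in_circle a b k}"
  let ?v = "\<lambda>k. if k \<in> ?S then swap (w k) else w k"
  have ends: "?S \<subseteq> ends (fst a)" "?S \<subseteq> ends (fst b)"
    unfolding in_circle_def by (auto simp: conn1_def)
  have sat: "saturated (fst a \<union> fst b) ?S"
    unfolding saturated_def
  proof clarify
    fix i j assume "(i, j) \<in> fst a \<union> fst b"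
    then have "j \<in> component (fst a \<union> fst b) i"
      using saturatedD[OF component_saturated, of i j "fst a \<union> fst b" i] component_self[of i "fst a \<union> fst b"] by blast
    then have eq: "component (fst a \<union> fst b) j = component (fst a \<union> fst b) i" by (rule component_eq)
    \<comment> \<open>In this form being on a circle depends on the component alone.\<close>
    have "in_circle a b k \<longleftrightarrow> component (fst a \<union> fst b) k \<subseteq> ends (fst a) \<inter> ends (fst b)" for k
      using component_self[of k "fst a \<union> fst b"] unfolding in_circle_def component_conn1 by blast
    then show "i \<in> ?S \<longleftrightarrow> j \<in> ?S" using eq by simp
  qed
  have oriented: "oriented c ?v" if c: "cup_diagram c" "oriented c w" "?S \<subseteq> ends (fst c)" "saturated (fst c) ?S" for c
    unfolding oriented_def
  proof (intro conjI ballI allI impI)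
    fix k assume "k \<notin> ends (fst c)" "k \<notin> snd c"
    then show "?v k \<in> {Circ, Cross}" using c(2,3) unfolding oriented_def by auto
  next
    fix p assume p: "p \<in> fst c"
    obtain i j where "p = (i, j)" by (cases p)
    then show "case p of (i, j) \<Rightarrow> {?v i, ?v j} = {Dn, Up}"
      using p saturatedD[OF c(4), of i j] orientedD(1)[OF c(2), of i j] swap_opposite[of "w i" "w j"] by auto
  next
    fix k assume "k \<in> snd c"
    then show "?v k \<in> {Dn, Up}" using orientedD(2)[OF c(2)] swap_in by simp
  next
    fix k l assume k: "k \<in> snd c" "l \<in> snd c" "k < l"
    then have "k \<notin> ?S" "l \<notin> ?S" using c(3) cup_diagramD(7)[OF c(1)] by blast+
    then show "\<not> (?v k = Dn \<and> ?v l = Up)" using orientedD(3)[OF c(2) k] by simp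
  qed
  have satab: "saturated (fst a) ?S" "saturated (fst b) ?S"
    using saturated_mono[OF sat] by blast+
  note flip = block_rel_flip[where w = w, OF cup_diagramD(1)[OF A] cup_diagram_matching[OF A] orientedD(1)[OF X(6)] satab(1) ends(1)]
  have "?v \<in> \<Lambda>"
    by (rule block_mem(3)[OF block X(5)], rule flip(2), assumption, rule block_mem(1)[OF block X(5)], rule flip(1))
  then have "(b, ?v, a) \<in> basisH \<Lambda>"
    using basisHI[OF X(4,3)] oriented[OF A X(6) ends(1) satab(1)] oriented[OF B X(7) ends(2) satab(2)]
    unfolding X(1,2) by blast
  then show ?thesis by (simp add: x sharp_def)
qed

text \<open>With all cups clockwise, interchanging the labels vee and wedge gives an orientation of
  degree zero; the ray condition survives because all rays carry the same label.\<close>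
lemma top_degree_eq:
  assumes z: "(c, u, d) \<in> basisH \<Lambda>" and deg: "deg (c, u, d) = 2 * defB \<Lambda>"
  shows "c = d" "\<And>i j. (i, j) \<in> fst c \<Longrightarrow> u i = Up \<and> u j = Dn"
proof -
  obtain \<gamma> \<delta> where Z: "c = lower \<gamma>" "d = lower \<delta>" "\<gamma> \<in> core \<Lambda>" "\<delta> \<in> core \<Lambda>" "u \<in> \<Lambda>"
    "oriented c u" "oriented d u" using z by (rule basisHE)
  note C = core_lower[OF Z(3), folded Z(1)] and D = core_lower[OF Z(4), folded Z(2)]
  obtain s where s: "s \<in> {Dn, Up}"
    "\<And>\<alpha> w r. \<alpha> \<in> core \<Lambda> \<Longrightarrow> w \<in> \<Lambda> \<Longrightarrow> oriented (lower \<alpha>) w \<Longrightarrow> r \<in> snd (lower \<alpha>) \<Longrightarrow> w r = s"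
    using core_ray_label by blast
  have le: "cdeg e u \<le> card (fst e)" if "cup_diagram e" for e
    unfolding cdeg_def by (rule card_mono[OF cup_diagramD(1)[OF that]]) auto
  have full: "u i = Up" if "cup_diagram e" "cdeg e u = card (fst e)" "(i, j) \<in> fst e" for e i j
  proof -
    have "{p \<in> fst e. u (fst p) = Up} = fst e"
      by (rule card_subset_eq[OF cup_diagramD(1)[OF that(1)]]) (use that(2) in \<open>auto simp: cdeg_def\<close>)
    then have "(i, j) \<in> {p \<in> fst e. u (fst p) = Up}" using that(3) by (simp only:)
    then show ?thesis by simp
  qed
  have "cdeg c u + cdeg d u = 2 * defB \<Lambda>" using deg by (simp add: deg_def)
  \<comment> \<open>Each of the two degrees is at most the defect, so a total of twice the defect
    forces equality in both.\<close>
  then have eqs: "cdeg c u = card (fst c)" "cdeg d u = card (fst d)"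
    using le[OF C(3)] le[OF D(3)] C(6) D(6) by linarith+
  have lab: "u i = Up \<and> u j = Dn" if "cup_diagram e" "cdeg e u = card (fst e)" "oriented e u" "(i, j) \<in> fst e" for e i j
    using full[OF that(1,2,4)] orientedD(1)[OF that(3,4)] by (auto simp: doubleton_eq_iff)
  \<comment> \<open>Both outer diagrams are degree-zero diagrams of the swapped labelling, hence
    equal. That labelling may leave the block: \<open>cup_diagram_eq_mdiag\<close> holds for
    arbitrary labellings.\<close>
  have "e = mdiag (swap \<circ> u)"
    if e: "cup_diagram e" "cdeg e u = card (fst e)" "oriented e u" "\<And>r. r \<in> snd e \<Longrightarrow> u r = s" for e
  proof (rule cup_diagram_eq_mdiag[OF e(1)])
    show "oriented e (swap \<circ> u)"
      unfolding oriented_def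
    proof (intro conjI ballI allI impI)
      fix k assume "k \<notin> ends (fst e)" "k \<notin> snd e"
      then show "(swap \<circ> u) k \<in> {Circ, Cross}" using e(3) unfolding oriented_def by auto
    next
      fix p assume "p \<in> fst e"
      then show "case p of (i, j) \<Rightarrow> {(swap \<circ> u) i, (swap \<circ> u) j} = {Dn, Up}"
        using orientedD(1)[OF e(3), of "fst p" "snd p"] swap_opposite[of "u (fst p)" "u (snd p)"] by (cases p) auto
    next
      fix k assume "k \<in> snd e"
      then show "(swap \<circ> u) k \<in> {Dn, Up}" using orientedD(2)[OF e(3)] swap_in by simp
    next
      fix k l assume "k \<in> snd e" "l \<in> snd e"
      then show "\<not> ((swap \<circ> u) k = Dn \<and> (swap \<circ> u) l = Up)" using e(4) by simp
    qed
    have "{p \<in> fst e. (swap \<circ> u) (fst p) = Up} = {}"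
      using lab[OF e(1-3)] by fastforce
    then show "cdeg e (swap \<circ> u) = 0" unfolding cdeg_def by (simp only: card.empty)
  qed
  from this[OF C(3) eqs(1) Z(6)] this[OF D(3) eqs(2) Z(7)]
  show "c = d" using s(2)[OF Z(3,5)] s(2)[OF Z(4,5)] Z by simp
  show "u i = Up \<and> u j = Dn" if "(i, j) \<in> fst c" for i j
    by (rule lab[OF C(3) eqs(1) Z(6) that])
qed

text \<open>Ray labels and free vertices are common to all orientations in the block, so the top
  weight depends on the diagram only, whichever \<open>w\<close> it is built from.\<close>

lemma top_weight_unique:
  assumes \<alpha>: "\<alpha> \<in> core \<Lambda>" and w: "w \<in> \<Lambda>" "oriented (lower \<alpha>) w" and u: "u \<in> \<Lambda>" "oriented (lower \<alpha>) u"
    and cups: "\<And>i j. (i, j) \<in> fst (lower \<alpha>) \<Longrightarrow> u i = Up \<and> u j = Dn"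
  shows "u = top_weight (lower \<alpha>) w"
proof
  fix k
  let ?c = "lower \<alpha>"
  obtain s where s: "s \<in> {Dn, Up}"
    "\<And>\<alpha> w r. \<alpha> \<in> core \<Lambda> \<Longrightarrow> w \<in> \<Lambda> \<Longrightarrow> oriented (lower \<alpha>) w \<Longrightarrow> r \<in> snd (lower \<alpha>) \<Longrightarrow> w r = s"
    using core_ray_label by blast
  show "u k = top_weight ?c w k"
  proof (cases "k \<in> ends (fst ?c)")
    case True
    then show ?thesis using cups by (fastforce simp: top_weight_def ends_def)
  next
    case False
    have "u k = w k"
    proof (cases "k \<in> snd ?c")
      case True
      then have "u k = s" "w k = s" using s(2)[OF \<alpha>] w u by blast+
      then show ?thesis by simp
    next
      case n: False
      then have "w k \<notin> {Dn, Up}" using oriented_nonfree[OF w(2)] False by blast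
      then show ?thesis by (rule block_rel_free[OF block_mem(2)[OF block w(1) u(1)]])
    qed
    then show ?thesis using False by (simp add: top_weight_def ends_def)
  qed
qed

lemma top_basis:
  assumes \<alpha>: "\<alpha> \<in> core \<Lambda>"
  shows "(lower \<alpha>, top_weight (lower \<alpha>) \<alpha>, lower \<alpha>) \<in> basisH \<Lambda>"
    and "deg (lower \<alpha>, top_weight (lower \<alpha>) \<alpha>, lower \<alpha>) = 2 * defB \<Lambda>"
    and "oriented (lower \<alpha>) (top_weight (lower \<alpha>) \<alpha>)"
    and "top_weight (lower \<alpha>) \<alpha> \<in> \<Lambda>"
    and "(i, j) \<in> fst (lower \<alpha>) \<Longrightarrow> top_weight (lower \<alpha>) \<alpha> i = Up \<and> top_weight (lower \<alpha>) \<alpha> j = Dn"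
proof -
  let ?c = "lower \<alpha>"
  let ?u = "top_weight ?c \<alpha>"
  note C = core_lower[OF \<alpha>]
  note D = cup_diagramD[OF C(3)]
  have lab: "?u i = Up \<and> ?u j = Dn" if "(i, j) \<in> fst ?c" for i j
  proof -
    have "j \<notin> fst ` fst ?c" using D(5)[OF that] by auto
    moreover have "i \<in> fst ` fst ?c" "j \<in> snd ` fst ?c" using that by force+
    ultimately show ?thesis by (simp add: top_weight_def)
  qed
  then show "(i, j) \<in> fst ?c \<Longrightarrow> ?u i = Up \<and> ?u j = Dn" .
  have out: "?u k = \<alpha> k" if "k \<notin> ends (fst ?c)" for k
    using that by (simp add: top_weight_def ends_def)
  show o: "oriented ?c ?u"
    unfolding oriented_def
  proof (intro conjI ballI allI impI)
    fix k assume k: "k \<notin> ends (fst ?c)" "k \<notin> snd ?c"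
    then show "?u k \<in> {Circ, Cross}" using C(4) out[OF k(1)] unfolding oriented_def by simp
  next
    fix p assume "p \<in> fst ?c"
    then show "case p of (i, j) \<Rightarrow> {?u i, ?u j} = {Dn, Up}"
      using lab[of "fst p" "snd p"] by (cases p) auto
  next
    fix k assume k: "k \<in> snd ?c"
    then have "k \<notin> ends (fst ?c)" using D(7) by blast
    then show "?u k \<in> {Dn, Up}" using orientedD(2)[OF C(4) k] out by simp
  next
    fix k l assume k: "k \<in> snd ?c" "l \<in> snd ?c" "k < l"
    then have "k \<notin> ends (fst ?c)" "l \<notin> ends (fst ?c)" using D(7) by blast+
    then show "\<not> (?u k = Dn \<and> ?u l = Up)" using orientedD(3)[OF C(4) k] out by simp
  qed
  \<comment> \<open>All cups of the lower diagram of \<open>\<alpha>\<close> are anticlockwise for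
    \<open>\<alpha>\<close>, so making them clockwise swaps both ends of each cup and stays in the
    block.\<close>
  have u: "?u = (\<lambda>k. if k \<in> ends (fst ?c) then swap (\<alpha> k) else \<alpha> k)"
  proof
    fix k
    show "?u k = (if k \<in> ends (fst ?c) then swap (\<alpha> k) else \<alpha> k)"
    proof (cases "k \<in> ends (fst ?c)")
      case True
      then obtain i j where "(i, j) \<in> fst ?c" "k = i \<or> k = j" by (auto elim: endsE)
      then show ?thesis using True lab cdeg_zeroD[OF C(3,4,5)] by auto
    qed (simp add: out)
  qed
  have sat: "saturated (fst ?c) (ends (fst ?c))" using endsI by (auto simp: saturated_def)
  note flip = block_rel_flip[where w = \<alpha>, OF D(1) cup_diagram_matching[OF C(3)] orientedD(1)[OF C(4)] sat subset_refl]
  show m: "?u \<in> \<Lambda>"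
    unfolding u by (rule block_mem(3)[OF block C(1)], rule flip(2), assumption, rule C(2), rule flip(1))
  show "(?c, ?u, ?c) \<in> basisH \<Lambda>" by (rule basisHI[OF \<alpha> \<alpha> m o o])
  have "{p \<in> fst ?c. ?u (fst p) = Up} = fst ?c" using lab by auto
  then have "cdeg ?c ?u = defB \<Lambda>" using C(6) by (simp add: cdeg_def)
  then show "deg (?c, ?u, ?c) = 2 * defB \<Lambda>" by (simp add: deg_def)
qed

text \<open>A top-degree vector is determined by its right outer diagram, which all terms of a
  product share. On products the trace is thus evaluation at one basis vector, and linearity is
  immediate.\<close>

lemma tau_eval:
  assumes \<delta>: "\<delta> \<in> core \<Lambda>" and g: "\<And>z. g z \<noteq> 0 \<Longrightarrow> snd (snd z) = lower \<delta>"
  shows "tau \<Lambda> g = g (lower \<delta>, top_weight (lower \<delta>) \<delta>, lower \<delta>)"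
proof -
  let ?z = "(lower \<delta>, top_weight (lower \<delta>) \<delta>, lower \<delta>)"
  let ?S = "{z \<in> basisH \<Lambda>. g z \<noteq> 0 \<and> deg z = 2 * defB \<Lambda>}"
  have "z = ?z" if "z \<in> ?S" for z
  proof -
    obtain c u d where z: "z = (c, u, d)" by (metis prod_cases3)
    have b: "(c, u, d) \<in> basisH \<Lambda>" and deg: "deg (c, u, d) = 2 * defB \<Lambda>" and d: "d = lower \<delta>"
      using that g[of z] by (auto simp: z)
    have cd: "c = lower \<delta>" using top_degree_eq(1)[OF b deg] d by simp
    obtain u: "u \<in> \<Lambda>" "oriented (lower \<delta>) u" using b d by (elim basisHE) blast
    have "u = top_weight (lower \<delta>) \<delta>"
      by (rule top_weight_unique[OF \<delta> core_lower(1,4)[OF \<delta>] u])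
        (rule top_degree_eq(2)[OF b deg, unfolded cd])
    then show ?thesis using z cd d by simp
  qed
  then have sub: "?S \<subseteq> {?z}" by blast
  have "tau \<Lambda> g = sum g {?z}"
    unfolding tau_def
    by (rule sum.mono_neutral_left) (use sub top_basis[OF \<delta>] in auto)
  then show ?thesis by simp
qed

lemma tau_prod:
  assumes x: "x \<in> basisH \<Lambda>" and y: "y \<in> basisH \<Lambda>"
  shows "tau \<Lambda> (prod_basis x y) = (if y = sharp x then 1 else 0)"
proof -
  obtain a w b where xe: "x = (a, w, b)" by (metis prod_cases3)
  obtain c v d where ye: "y = (c, v, d)" by (metis prod_cases3)
  obtain \<gamma> \<delta> where Y: "c = lower \<gamma>" "d = lower \<delta>" "\<gamma> \<in> core \<Lambda>" "\<delta> \<in> core \<Lambda>" "v \<in> \<Lambda>"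
    "oriented c v" "oriented d v" using y unfolding ye by (rule basisHE)
  let ?z = "(d, top_weight d \<delta>, d)"
  have tz: "tau \<Lambda> (prod_basis x y) = prod_basis x y ?z"
    unfolding Y(2) by (rule tau_eval[OF Y(4)]) (use prod_basis_nonzero[of x y] ye Y(2) in auto)
  show ?thesis
  proof (cases "c = b \<and> d = a")
    case False
    then have "prod_basis x y ?z = 0" using prod_basis_nonzero[of x y ?z] xe ye by auto
    moreover have "y \<noteq> sharp x" using False by (auto simp: xe ye sharp_def)
    ultimately show ?thesis using tz by simp
  next
    case True
    have xb: "(a, w, b) \<in> basisH \<Lambda>" and yb: "(b, v, a) \<in> basisH \<Lambda>" using x y xe ye True by auto
    have a: "a = lower \<delta>" using True Y(2) by simp
    obtain W: "w \<in> \<Lambda>" "oriented a w" using xb by (elim basisHE) blast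
    let ?L = "\<lambda>n. if fst n then v (snd n) else w (snd n)"
    obtain s where "stack a b s ?L" using stack_of_basis[OF xb yb] .
    then interpret stack a b s ?L .
    have less: "i < j" if "(i, j) \<in> fst a" for i j
      using cup_diagramD(2)[OF core_lower(3)[OF Y(4)]] that a by blast
    have tw: "top_weight a \<delta> = top_weight a w"
      using top_weight_unique[OF Y(4) W[unfolded a] top_basis(4)[OF Y(4)] top_basis(3)[OF Y(4)] top_basis(5)[OF Y(4)]] a
      by simp
    have "prod_basis x y ?z = of_bool (good (fst b) ?L)"
      using top_coefficient[OF less refl] True tw by (simp add: prod_basis_def xe ye Let_def)
    also have "good (fst b) ?L \<longleftrightarrow> v = (\<lambda>k. if in_circle a b k then swap (w k) else w k)"
    proof -
      \<comment> \<open>\<open>good_initial\<close> compares labels on \<open>V\<close> only; off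
        \<open>V\<close> the labels are circles and crosses, common to the whole block.\<close>
      have "v k = (if in_circle a b k then swap (w k) else w k)" if k: "k \<notin> V" for k
      proof -
        have "w k \<notin> {Dn, Up}" using k oriented_nonfree[OF W(2)] unfolding V_def by blast
        then have "v k = w k" by (rule block_rel_free[OF block_mem(2)[OF block W(1) Y(5)]])
        then show ?thesis using k by (simp add: uncut_iff_in_circle)
      qed
      then show ?thesis unfolding good_initial fun_eq_iff by auto
    qed
    also have "\<dots> \<longleftrightarrow> y = sharp x" using True by (simp add: xe ye sharp_def)
    finally show ?thesis using tz by simp
  qed
qed

text \<open>Pairing with the # of a basis vector from the support isolates its coefficient, because
  # is injective.\<close>

lemma tau_nondegenerate:
  assumes fin: "finite {z. g z \<noteq> 0}" and sub: "{z. g z \<noteq> 0} \<subseteq> basisH \<Lambda>" and nz: "g \<noteq> (\<lambda>_. 0)"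
  shows "\<exists>y\<in>basisH \<Lambda>. tau \<Lambda> (prod_left g y) \<noteq> 0"
proof -
  obtain x where x: "g x \<noteq> 0" using nz by blast
  then have xb: "x \<in> basisH \<Lambda>" using sub by blast
  define y where "y = sharp x"
  have yb: "y \<in> basisH \<Lambda>" unfolding y_def by (rule sharp_basis[OF xb])
  obtain c v d where ye: "y = (c, v, d)" by (metis prod_cases3)
  obtain \<delta> where d: "d = lower \<delta>" "\<delta> \<in> core \<Lambda>" using yb unfolding ye by (elim basisHE) blast
  let ?z = "(lower \<delta>, top_weight (lower \<delta>) \<delta>, lower \<delta>)"
  have supp: "snd (snd z) = lower \<delta>" if "prod_basis x' y z \<noteq> 0" for x' z
    using prod_basis_nonzero[OF that] ye d by simp
  have "snd (snd z) = lower \<delta>" if nz: "prod_left g y z \<noteq> 0" for z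
  proof -
    obtain x' where "g x' * prod_basis x' y z \<noteq> 0"
      using nz unfolding prod_left_def by (rule sum.not_neutral_contains_not_neutral)
    then have "prod_basis x' y z \<noteq> 0" by simp
    then show ?thesis by (rule supp)
  qed
  then have "tau \<Lambda> (prod_left g y) = prod_left g y ?z" by (rule tau_eval[OF d(2)])
  also have "\<dots> = (\<Sum>x'\<in>{x. g x \<noteq> 0}. g x' * tau \<Lambda> (prod_basis x' y))"
    unfolding prod_left_def by (simp only: tau_eval[OF d(2) supp])
  also have "\<dots> = (\<Sum>x'\<in>{x. g x \<noteq> 0}. if x' = x then g x' else 0)"
  proof (rule sum.cong[OF refl])
    fix x' assume "x' \<in> {x. g x \<noteq> 0}"
    then have x': "x' \<in> basisH \<Lambda>" using sub by blast
    have "y = sharp x' \<longleftrightarrow> x' = x" unfolding y_def using sharp_sharp by metis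
    then show "g x' * tau \<Lambda> (prod_basis x' y) = (if x' = x then g x' else 0)"
      using tau_prod[OF x' yb] by simp
  qed
  also have "\<dots> = g x" using fin x by simp
  finally have "tau \<Lambda> (prod_left g y) \<noteq> 0" using x by simp
  then show ?thesis using yb by blast
qed

end

theorem theorem6p3:
  assumes "is_block \<Lambda>"
    and "bdd_above (defect ` \<Lambda>)"
    and "x \<in> basisH \<Lambda>" and "y \<in> basisH \<Lambda>"
  shows "tau \<Lambda> (prod_basis x y) = (if y = sharp x then 1 else 0)
       \<and> tau \<Lambda> (prod_basis x y) = tau \<Lambda> (prod_basis y x)
       \<and> (\<forall>g. finite {z. g z \<noteq> 0} \<and> {z. g z \<noteq> 0} \<subseteq> basisH \<Lambda> \<and> g \<noteq> (\<lambda>_. 0)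
              \<longrightarrow> (\<exists>y'\<in>basisH \<Lambda>. tau \<Lambda> (prod_left g y') \<noteq> 0))"
proof -
  interpret finite_block \<Lambda> by unfold_locales (rule assms)+
  \<comment> \<open>Since # is an involution, the pairing is 1 in one order exactly when it is 1 in
    the other.\<close>
  have "y = sharp x \<longleftrightarrow> x = sharp y" using sharp_sharp by metis
  then show ?thesis
    using tau_prod[OF assms(3,4)] tau_prod[OF assms(4,3)] tau_nondegenerate by auto
qed

end
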